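(* Let $a\in(-\infty,0)\cup(0,1)$ and let $\omega\in\mathbb D_a$ satisfy $R_a(\omega)=\omega$; let $L_\omega=\sup\{x:\omega(x)>0\}$. Then: (1) if $a<0$, $\omega>0$ on $\mathbb R$ and $\omega'\in H^k(\mathbb R)$ for every integer $k\ge0$; (2) if $0<a<1$, $\omega$ is supported on $[-L_\omega,L_\omega]$ with $L_\omega<\infty$, and $\omega$ is $C^\infty$ on the open interval $(-L_\omega,L_\omega)$.
   Context: Let $\rho(x)=(1+|x|)^{-1/2}$ and $\eta_a=\frac{1}{2^{9/2}(4+|a|)^3}$. $\mathbb D_a$ is the set of continuous even functions $\omega$ on $\mathbb R$ with $\|\rho\omega\|_{L^\infty}<\infty$ such that $\omega(0)=1$; $(1-x^2)_+\le\omega(x)\le1$ for all $x$; $\omega$ is non-increasing on $[0,\infty)$; $s\mapsto\omega(\sqrt s)$ is convex on $[0,\infty)$; and the left derivative satisfies $\omega'_-(1/2)\le-\eta_a$. $T(\omega)(x)=\frac1\pi\int_0^\infty\ln\left|\frac{x^2-y^2}{y^2}\right|\omega(y)\,dy$, $r(\omega)=\frac1\pi\int_0^\infty\frac{\omega(0)-\omega(y)}{y^2}\,dy$, and for $a\ne0$, $R_a(\omega)(x)=\big(1-\frac{aT(\omega)(x)}{r(\omega)}\big)_+^{1/a}$. $H^k$ denotes the $L^2$-based Sobolev space of order $k$. *)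

theory Defs
  imports "HOL-Analysis.Analysis"
begin

definition rho :: "real \<Rightarrow> real" where
  "rho x = (1 + \<bar>x\<bar>) powr (-1/2)"

definition eta :: "real \<Rightarrow> real" where
  "eta a = 1 / (2 powr (9/2) * (4 + \<bar>a\<bar>) ^ 3)"

definition Dset :: "real \<Rightarrow> (real \<Rightarrow> real) set" where
  "Dset a = {\<omega>. continuous_on UNIV \<omega>
      \<and> (\<forall>x. \<omega> (-x) = \<omega> x)
      \<and> (\<exists>B. \<forall>x. \<bar>rho x * \<omega> x\<bar> \<le> B)
      \<and> \<omega> 0 = 1
      \<and> (\<forall>x. max 0 (1 - x^2) \<le> \<omega> x \<and> \<omega> x \<le> 1)
      \<and> (\<forall>x y. 0 \<le> x \<longrightarrow> x \<le> y \<longrightarrow> \<omega> y \<le> \<omega> x)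
      \<and> convex_on {0..} (\<lambda>s. \<omega> (sqrt s))
      \<and> (\<exists>L. ((\<lambda>h. (\<omega> (1/2 + h) - \<omega> (1/2)) / h) \<longlongrightarrow> L) (at_left 0) \<and> L \<le> - eta a)}"

definition Top :: "(real \<Rightarrow> real) \<Rightarrow> real \<Rightarrow> real" where
  "Top \<omega> x = (1/pi) * (LBINT y:{0<..}. ln \<bar>(x^2 - y^2) / y^2\<bar> * \<omega> y)"

definition rfun :: "(real \<Rightarrow> real) \<Rightarrow> real" where
  "rfun \<omega> = (1/pi) * (LBINT y:{0<..}. (\<omega> 0 - \<omega> y) / y^2)"

text \<open>R_a(omega)(x) = (1 - a T(omega)(x)/r(omega))_+^(1/a), valued in the extended reals:
  a zero base raised to the negative power 1/a (case a < 0) is +infinity.\<close>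
definition Ra :: "real \<Rightarrow> (real \<Rightarrow> real) \<Rightarrow> real \<Rightarrow> ereal" where
  "Ra a \<omega> x = (let b = max 0 (1 - a * Top \<omega> x / rfun \<omega>) in
      if b > 0 then ereal (b powr (1/a))
      else if a > 0 then 0 else \<infinity>)"

definition smooth_on_set :: "real set \<Rightarrow> (real \<Rightarrow> real) \<Rightarrow> bool" where
  "smooth_on_set S f \<longleftrightarrow> (\<exists>fs :: nat \<Rightarrow> real \<Rightarrow> real. fs 0 = f \<and>
      (\<forall>n. \<forall>x\<in>S. (fs n has_real_derivative fs (Suc n) x) (at x)))"

definition test_fun :: "(nat \<Rightarrow> real \<Rightarrow> real) \<Rightarrow> bool" where
  "test_fun fs \<longleftrightarrow> (\<forall>n x. (fs n has_real_derivative fs (Suc n) x) (at x))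
      \<and> (\<exists>K. compact K \<and> (\<forall>x. x \<notin> K \<longrightarrow> fs 0 x = 0))"

definition weak_deriv :: "(real \<Rightarrow> real) \<Rightarrow> (real \<Rightarrow> real) \<Rightarrow> bool" where
  "weak_deriv f g \<longleftrightarrow> (\<forall>a b. set_integrable lborel {a..b} g)
      \<and> (\<forall>fs. test_fun fs \<longrightarrow>
            (LINT x|lborel. f x * fs 1 x) = - (LINT x|lborel. g x * fs 0 x))"

definition L2 :: "(real \<Rightarrow> real) \<Rightarrow> bool" where
  "L2 f \<longleftrightarrow> f \<in> borel_measurable lborel \<and> integrable lborel (\<lambda>x. (f x)^2)"

definition sobolev_H :: "nat \<Rightarrow> (real \<Rightarrow> real) \<Rightarrow> bool" where
  "sobolev_H k f \<longleftrightarrow> (\<exists>gs :: nat \<Rightarrow> real \<Rightarrow> real. gs 0 = f \<and>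
      (\<forall>j\<le>k. L2 (gs j) \<and>
        (\<forall>fs. test_fun fs \<longrightarrow>
           (LINT x|lborel. f x * fs j x) = (-1)^j * (LINT x|lborel. gs j x * fs 0 x))))"

end

theory Submission
  imports Defs
begin

text \<open>
  Convexity of \<open>s \<mapsto> \<omega> (sqrt s)\<close> makes \<open>\<omega>\<close> globally Lipschitz with \<open>\<omega>' = O(1/x)\<close>, so the
  symmetric integral \<open>hil x = \<integral>\<^sub>0\<^sup>\<infinity> (\<omega> (x - t) - \<omega> (x + t)) / t dt\<close> converges absolutely, is bounded,
  and \<open>\<pi> T(\<omega>)' = hil\<close>. Where \<open>\<omega> > 0\<close> the fixed point equation becomes
  \<open>(\<omega>\<^sup>q)' = - q / (\<pi> r) \<omega>\<^sup>q\<^sup>-\<^sup>a hil\<close>. The Hilbert transform preserves Hoelder classes up to a loss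
  in the exponent, so each use of this identity gains one derivative. For \<open>a < 0\<close> all bounds are uniform
  on the line and every derivative of \<open>\<omega>\<close> is \<open>\<omega>\<^sup>1\<^sup>-\<^sup>a\<close> times a bounded function; for \<open>a > 0\<close> they
  are uniform on compact subintervals of \<open>{\<omega> > 0}\<close>.

  With \<open>M x = \<integral>\<^sub>0\<^sup>x (\<omega> y - \<omega> x) dy\<close> one has \<open>hil x \<ge> M x / x\<close>. Since \<open>M\<close> is increasing, \<open>T(\<omega>)\<close> grows
  at least logarithmically, which forces compact support for \<open>a > 0\<close>. For \<open>a < 0\<close> it gives
  \<open>(ln M)' \<ge> \<omega>\<^sup>1\<^sup>-\<^sup>a / (\<pi> r)\<close>, and \<open>M x \<le> x\<close> yields \<open>\<omega>\<^sup>1\<^sup>-\<^sup>a = O(ln x / x)\<close>, which is square integrable.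
\<close>

section \<open>Integrals of power functions and differentiation under the integral sign\<close>

text \<open>Two obstacles shape the proof. The kernel of T(w) is singular at y = x, and no decay of
  w is available a priori, so T(w) cannot be differentiated under the integral directly. The odd
  primitive \<open>Om\<close> of w replaces it: integrating the integrand of \<open>hil\<close> in x
  gives \<open>pot\<close>, which can be so differentiated, and \<open>pot = pi * T(w)\<close>
  follows by cutting both integrals at B, rewriting them in terms of difference quotients of
  \<open>Om\<close> and letting B tend to infinity. The tail of \<open>hil\<close> is likewise
  integrated by parts before it is differentiated, since w is at first only known to be Lipschitz.
  The second obstacle is the exponent: differentiating w^q produces w^(q - a). For a < 0 all
  exponents that occur remain positive, where w^q \<le> 1 on the whole line. For a > 0 they become
  negative, so w must be bounded below; this forces work on intervals inside the support, with a
  margin given up at every round.\<close>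

lemma has_real_derivative_integral_dominated:
  fixes f f' :: "real \<Rightarrow> 'a \<Rightarrow> real"
  assumes "d > 0"
    and int: "\<And>x. \<bar>x - x0\<bar> < d \<Longrightarrow> integrable M (f x)"
    and der: "\<And>x t. \<bar>x - x0\<bar> < d \<Longrightarrow> ((\<lambda>x. f x t) has_real_derivative f' x t) (at x)"
    and bnd: "\<And>x t. \<bar>x - x0\<bar> < d \<Longrightarrow> \<bar>f' x t\<bar> \<le> g t"
    and g: "integrable M g"
  shows "((\<lambda>x. \<integral>t. f x t \<partial>M) has_real_derivative (\<integral>t. f' x0 t \<partial>M)) (at x0)"
proof -
  have lip: "\<bar>f (x0 + h) t - f x0 t\<bar> \<le> \<bar>h\<bar> * g t" if h: "\<bar>h\<bar> < d" for h t
  proof -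
    have sub: "closed_segment x0 (x0 + h) \<subseteq> {x. \<bar>x - x0\<bar> < d}"
      using h by (auto simp: closed_segment_eq_real_ivl split: if_splits)
    have "norm (f (x0 + h) t - f x0 t) \<le> g t * norm (x0 + h - x0)"
    proof (rule field_differentiable_bound[where S = "closed_segment x0 (x0 + h)" and f' = "\<lambda>x. f' x t"])
      fix z assume "z \<in> closed_segment x0 (x0 + h)"
      then have z: "\<bar>z - x0\<bar> < d" using sub by auto
      show "((\<lambda>x. f x t) has_field_derivative f' z t) (at z within closed_segment x0 (x0 + h))"
        using der[OF z] by (rule has_field_derivative_at_within)
      show "norm (f' z t) \<le> g t" using bnd[OF z] by simp
    qed auto
    then show ?thesis by (simp add: mult.commute)
  qed
  have lim: "((\<lambda>h. (f (x0 + h) t - f x0 t) / h) \<longlongrightarrow> f' x0 t) (at 0)" for t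
    using der[of x0 t] \<open>d > 0\<close> by (simp add: DERIV_def)
  show ?thesis
    unfolding DERIV_def tendsto_at_iff_sequentially
  proof (intro allI impI)
    fix X :: "nat \<Rightarrow> real"
    assume X0: "\<forall>i. X i \<in> UNIV - {0}" and X: "X \<longlonglongrightarrow> 0"
    \<comment> \<open>\<open>X\<close> may leave the neighbourhood for finitely many indices.
      Replacing those terms by d / 2 makes every quotient integrable and dominated without changing
      the limit.\<close>
    define Y where "Y i = (if \<bar>X i\<bar> < d then X i else d / 2)" for i
    have ev: "eventually (\<lambda>i. Y i = X i) sequentially"
    proof -
      have "eventually (\<lambda>i. \<bar>X i\<bar> < d) sequentially"
        using X \<open>d > 0\<close> unfolding tendsto_iff dist_real_def by auto
      then show ?thesis by eventually_elim (simp add: Y_def)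
    qed
    have Y: "Y \<longlonglongrightarrow> 0"
      using X tendsto_cong[OF ev] by auto
    have Yn: "Y i \<noteq> 0" "\<bar>Y i\<bar> < d" for i
      using X0 \<open>d > 0\<close> by (auto simp: Y_def)
    have quot: "(\<lambda>i. (f (x0 + Y i) t - f x0 t) / Y i) \<longlonglongrightarrow> f' x0 t" for t
      using lim[of t] Y Yn(1) unfolding tendsto_at_iff_sequentially comp_def by auto
    have meas: "(\<lambda>t. (f (x0 + Y i) t - f x0 t) / Y i) \<in> borel_measurable M" for i
      using int[of x0] int[of "x0 + Y i"] Yn[of i] \<open>d > 0\<close> by (intro borel_measurable_divide borel_measurable_diff) auto
    have "(\<lambda>i. \<integral>t. (f (x0 + Y i) t - f x0 t) / Y i \<partial>M) \<longlonglongrightarrow> (\<integral>t. f' x0 t \<partial>M)"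
    proof (rule integral_dominated_convergence[where w = g])
      show "f' x0 \<in> borel_measurable M"
        by (rule borel_measurable_LIMSEQ_real[OF quot meas])
      show "AE t in M. norm ((f (x0 + Y i) t - f x0 t) / Y i) \<le> g t" for i
        using lip[OF Yn(2), of i] Yn(1)[of i] by (auto simp: abs_divide divide_simps mult.commute)
    qed (use g quot meas in auto)
    also have "(\<lambda>i. \<integral>t. (f (x0 + Y i) t - f x0 t) / Y i \<partial>M) =
        (\<lambda>i. ((\<integral>t. f (x0 + Y i) t \<partial>M) - (\<integral>t. f x0 t \<partial>M)) / Y i)"
      using int[of x0] int[of "x0 + Y i" for i] Yn \<open>d > 0\<close> by (auto simp: Bochner_Integration.integral_diff)
    finally show "((\<lambda>h. ((\<integral>t. f (x0 + h) t \<partial>M) - (\<integral>t. f x0 t \<partial>M)) / h) \<circ> X) \<longlonglongrightarrow> (\<integral>t. f' x0 t \<partial>M)"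
      unfolding comp_def by (rule Lim_transform_eventually) (use ev in \<open>auto elim: eventually_mono\<close>)
  qed
qed

lemma has_real_derivative_set_integral_dominated:
  fixes f f' :: "real \<Rightarrow> 'a \<Rightarrow> real"
  assumes "d > 0"
    and int: "\<And>x. \<bar>x - x0\<bar> < d \<Longrightarrow> set_integrable M A (f x)"
    and der: "\<And>x t. \<bar>x - x0\<bar> < d \<Longrightarrow> t \<in> A \<Longrightarrow> ((\<lambda>x. f x t) has_real_derivative f' x t) (at x)"
    and bnd: "\<And>x t. \<bar>x - x0\<bar> < d \<Longrightarrow> t \<in> A \<Longrightarrow> \<bar>f' x t\<bar> \<le> g t"
    and g: "set_integrable M A g"
  shows "((\<lambda>x. LINT t:A|M. f x t) has_real_derivative (LINT t:A|M. f' x0 t)) (at x0)"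
  unfolding set_lebesgue_integral_def
  by (rule has_real_derivative_integral_dominated[where d = d and g = "\<lambda>t. indicator A t *\<^sub>R g t"])
    (use assms in \<open>auto simp: set_integrable_def indicator_def\<close>)

lemma set_integrable_powr_Ioc:
  fixes p c :: real
  assumes "p > -1" "c \<ge> 0"
  shows "set_integrable lborel {0<..c} (\<lambda>t. t powr p)"
proof -
  have "(\<lambda>t. t powr p) absolutely_integrable_on {0<..c}"
    by (rule nonnegative_absolutely_integrable_1[OF integrable_on_powr_from_0'[OF assms]]) auto
  then show ?thesis
    unfolding set_integrable_def by (subst (asm) integrable_completion) auto
qed

lemma set_integrable_powr_Ioi:
  fixes p c :: real
  assumes "p < -1" "c > 0"
  shows "set_integrable lborel {c<..} (\<lambda>t. t powr p)"
proof -
  have "(\<lambda>t. t powr p) integrable_on {c..}"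
    using has_integral_powr_to_inf[OF assms] by blast
  then have "(\<lambda>t. t powr p) absolutely_integrable_on {c..}"
    by (rule nonnegative_absolutely_integrable_1) auto
  then have "set_integrable lborel {c..} (\<lambda>t. t powr p)"
    unfolding set_integrable_def by (subst (asm) integrable_completion) auto
  then show ?thesis by (rule set_integrable_subset) auto
qed

lemma set_integral_inverse_square_Ioi:
  fixes c :: real
  assumes "c > 0"
  shows "set_integrable lborel {c<..} (\<lambda>t. 1 / t^2)" "(LBINT t:{c<..}. 1 / t^2) = 1 / c"
proof -
  have eq: "t powr (-2) = 1 / t^2" if "t > c" for t
    using that assms by (simp add: powr_minus powr_numeral field_simps)
  have i: "set_integrable lborel {c<..} (\<lambda>t. t powr (-2))"
    using set_integrable_powr_Ioi[of "-2" c] assms by simp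
  show I: "set_integrable lborel {c<..} (\<lambda>t. 1 / t^2)"
    using i by (subst set_integrable_cong[OF refl refl, of _ _ "\<lambda>t. t powr (-2)"]) (auto simp: eq)
  have "(LBINT t:{c<..}. 1 / t^2) = integral {c<..} (\<lambda>t. 1 / t^2)"
    using set_borel_integral_eq_integral(2)[OF I] .
  also have "\<dots> = integral {c<..} (\<lambda>t. t powr (-2))"
    by (rule integral_cong) (auto simp: eq)
  also have "\<dots> = integral {c..} (\<lambda>t. t powr (-2))"
  proof (rule integral_subset_negligible)
    have "{c..} - {c<..} = {c}" by auto
    then show "negligible ({c..} - {c<..})" by simp
  qed auto
  also have "\<dots> = 1 / c"
    using has_integral_powr_to_inf[of "-2" c] assms by (auto intro!: integral_unique simp: powr_minus_divide)
  finally show "(LBINT t:{c<..}. 1 / t^2) = 1 / c" .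
qed

lemma set_borel_measurable_continuous_real:
  fixes f :: "real \<Rightarrow> real"
  assumes "continuous_on A f" "A \<in> sets borel"
  shows "set_borel_measurable lborel A f"
  using borel_measurable_continuous_on_indicator[OF assms(2,1)] by (simp add: set_borel_measurable_def)

lemma set_integrable_continuous_dominated:
  fixes f g :: "real \<Rightarrow> real"
  assumes g: "set_integrable lborel A g" and "A \<in> sets borel" "continuous_on A f"
    and "\<And>t. t \<in> A \<Longrightarrow> \<bar>f t\<bar> \<le> g t"
  shows "set_integrable lborel A f"
proof (rule set_integrable_bound[OF g set_borel_measurable_continuous_real])
  show "AE x in lborel. x \<in> A \<longrightarrow> norm (f x) \<le> norm (g x)"
    using assms(4) by (auto simp: order.trans[OF _ abs_ge_self])
qed (use assms in auto)

lemma set_integral_abs_le: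
  fixes f g :: "real \<Rightarrow> real"
  assumes f: "set_integrable lborel A f" and g: "set_integrable lborel A g"
    and "\<And>t. t \<in> A \<Longrightarrow> \<bar>f t\<bar> \<le> g t"
  shows "\<bar>LBINT t:A. f t\<bar> \<le> (LBINT t:A. g t)"
proof -
  have "norm (LBINT t:A. f t) \<le> (LBINT t:A. norm (f t))"
    by (rule set_integral_norm_bound[OF f])
  also have "\<dots> \<le> (LBINT t:A. g t)"
    by (rule set_integral_mono[OF set_integrable_norm[OF f] g]) (use assms in auto)
  finally show ?thesis by simp
qed

lemma split_Ioi: "0 < (c::real) \<Longrightarrow> {0<..} = {0<..c} \<union> {c<..}"
  by auto

text \<open>The shape of the majorants for the symmetric quotients of w: a constant at small t, from
  a Lipschitz estimate, and b / t^2 at large t, from cancellation.\<close>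

lemma set_integrable_piecewise:
  fixes c a b :: real
  assumes "0 < c"
  shows "set_integrable lborel {0<..} (\<lambda>t. if t \<le> c then a else b / t\<^sup>2)" (is ?I)
    "(LBINT t:{0<..}. if t \<le> c then a else b / t\<^sup>2) = a * c + b / c" (is ?V)
proof -
  let ?f = "\<lambda>t. if t \<le> c then a else b / t\<^sup>2"
  have "set_integrable lborel {0<..c} (\<lambda>t. a)"
    by (rule set_integrable_subset[of _ "{0..c}"]) (auto intro: borel_integrable_atLeastAtMost')
  then have 1: "set_integrable lborel {0<..c} ?f"
    by (subst set_integrable_cong[OF refl refl, of _ _ "\<lambda>t. a"]) auto
  have "set_integrable lborel {c<..} (\<lambda>t. b * (1 / t\<^sup>2))"
    by (intro set_integrable_mult_right set_integral_inverse_square_Ioi assms)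
  then have 2: "set_integrable lborel {c<..} ?f"
    by (subst set_integrable_cong[OF refl refl, of _ _ "\<lambda>t. b * (1 / t\<^sup>2)"]) auto
  show ?I unfolding split_Ioi[OF assms] by (rule set_integrable_Un[OF 1 2]) auto
  have "(LBINT t:{0<..}. ?f t) = (LBINT t:{0<..c}. ?f t) + (LBINT t:{c<..}. ?f t)"
    unfolding split_Ioi[OF assms] by (rule set_integral_Un[OF _ 1 2]) auto
  also have "(LBINT t:{0<..c}. ?f t) = (LBINT t:{0<..c}. a)"
    by (rule set_lebesgue_integral_cong) auto
  also have "\<dots> = a * c" using assms by (simp add: set_lebesgue_integral_def)
  also have "(LBINT t:{c<..}. ?f t) = (LBINT t:{c<..}. b * (1 / t\<^sup>2))"
    by (rule set_lebesgue_integral_cong) auto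
  also have "\<dots> = b / c"
    unfolding set_integral_mult_right set_integral_inverse_square_Ioi(2)[OF assms] by simp
  finally show ?V .
qed

section \<open>Hoelder classes and the local Hilbert transform\<close>

text \<open>The exponent is hidden by the quantifier so that the class is stable under the truncated
  Hilbert transform, which halves it. One constant serves for the supremum and the seminorm.\<close>

definition hoelder_bdd :: "real set \<Rightarrow> (real \<Rightarrow> real) \<Rightarrow> bool" where
  "hoelder_bdd S f \<longleftrightarrow> (\<exists>C \<alpha>. 0 < \<alpha> \<and> \<alpha> \<le> 1 \<and> (\<forall>x\<in>S. \<bar>f x\<bar> \<le> C)
     \<and> (\<forall>x\<in>S. \<forall>y\<in>S. \<bar>f x - f y\<bar> \<le> C * \<bar>x - y\<bar> powr \<alpha>))"

text \<open>The exponent may differ from one order of differentiation to the next.\<close>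

primrec hoelder_C :: "nat \<Rightarrow> real set \<Rightarrow> (real \<Rightarrow> real) \<Rightarrow> bool" where
  "hoelder_C 0 S f = hoelder_bdd S f"
| "hoelder_C (Suc n) S f =
     (hoelder_bdd S f \<and> (\<exists>f'. (\<forall>x\<in>S. (f has_real_derivative f' x) (at x)) \<and> hoelder_C n S f'))"

lemma hoelder_bddI:
  assumes "0 < \<alpha>" "\<alpha> \<le> 1" "\<And>x. x \<in> S \<Longrightarrow> \<bar>f x\<bar> \<le> C"
    "\<And>x y. x \<in> S \<Longrightarrow> y \<in> S \<Longrightarrow> \<bar>f x - f y\<bar> \<le> C * \<bar>x - y\<bar> powr \<alpha>"
  shows "hoelder_bdd S f"
  using assms unfolding hoelder_bdd_def by blast

lemma hoelder_bddE:
  assumes "hoelder_bdd S f"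
  obtains C \<alpha> where "0 < \<alpha>" "\<alpha> \<le> 1" "0 \<le> C" "\<And>x. x \<in> S \<Longrightarrow> \<bar>f x\<bar> \<le> C"
    "\<And>x y. x \<in> S \<Longrightarrow> y \<in> S \<Longrightarrow> \<bar>f x - f y\<bar> \<le> C * \<bar>x - y\<bar> powr \<alpha>"
proof -
  obtain C \<alpha> where C: "0 < \<alpha>" "\<alpha> \<le> 1" "\<And>x. x \<in> S \<Longrightarrow> \<bar>f x\<bar> \<le> C"
    "\<And>x y. x \<in> S \<Longrightarrow> y \<in> S \<Longrightarrow> \<bar>f x - f y\<bar> \<le> C * \<bar>x - y\<bar> powr \<alpha>"
    using assms unfolding hoelder_bdd_def by blast
  have le: "C * \<bar>x - y\<bar> powr \<alpha> \<le> \<bar>C\<bar> * \<bar>x - y\<bar> powr \<alpha>" for x y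
    by (intro mult_right_mono) auto
  show thesis
  proof (rule that[of \<alpha> "\<bar>C\<bar>"])
    show "\<bar>f x\<bar> \<le> \<bar>C\<bar>" if "x \<in> S" for x using C(3)[OF that] by simp
    show "\<bar>f x - f y\<bar> \<le> \<bar>C\<bar> * \<bar>x - y\<bar> powr \<alpha>" if "x \<in> S" "y \<in> S" for x y
      using C(4)[OF that] le[of x y] by linarith
  qed (use C in auto)
qed

text \<open>Here \<open>d\<close> is a distance and \<open>e\<close> an increment. For d \<le> 1 the
  smaller exponent gives the larger power; for d > 1 the sup bound 2 * C is already enough.\<close>

lemma hoelder_lower_exponent:
  fixes d e :: real
  assumes "0 < \<beta>" "\<beta> \<le> \<alpha>" "0 \<le> C" "0 \<le> d" "e \<le> 2 * C" "e \<le> C * d powr \<alpha>"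
  shows "e \<le> 2 * C * d powr \<beta>"
proof (cases "d \<le> 1")
  case True
  have "d powr \<alpha> \<le> d powr \<beta>"
    using True assms by (cases "d = 0") (auto intro: powr_mono')
  then have "C * d powr \<alpha> \<le> C * d powr \<beta>" using assms by (intro mult_left_mono)
  moreover have "0 \<le> C * d powr \<beta>" using assms by simp
  ultimately show ?thesis using assms(6) by linarith
next
  case False
  then have "1 \<le> d powr \<beta>" using assms by (simp add: ge_one_powr_ge_zero)
  then have "2 * C * 1 \<le> 2 * C * d powr \<beta>" using assms by (intro mult_left_mono) auto
  then show ?thesis using assms by linarith
qed

text \<open>Sums and products need one exponent for both factors; the smaller of the two
  works.\<close>

lemma hoelder_bddE_pair:
  assumes "hoelder_bdd S f" "hoelder_bdd S g"
  obtains C \<alpha> where "0 < \<alpha>" "\<alpha> \<le> 1" "0 \<le> C"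
    "\<And>x. x \<in> S \<Longrightarrow> \<bar>f x\<bar> \<le> C" "\<And>x. x \<in> S \<Longrightarrow> \<bar>g x\<bar> \<le> C"
    "\<And>x y. x \<in> S \<Longrightarrow> y \<in> S \<Longrightarrow> \<bar>f x - f y\<bar> \<le> C * \<bar>x - y\<bar> powr \<alpha>"
    "\<And>x y. x \<in> S \<Longrightarrow> y \<in> S \<Longrightarrow> \<bar>g x - g y\<bar> \<le> C * \<bar>x - y\<bar> powr \<alpha>"
proof -
  obtain C \<alpha> where C: "0 < \<alpha>" "\<alpha> \<le> 1" "0 \<le> C" "\<And>x. x \<in> S \<Longrightarrow> \<bar>f x\<bar> \<le> C"
    "\<And>x y. x \<in> S \<Longrightarrow> y \<in> S \<Longrightarrow> \<bar>f x - f y\<bar> \<le> C * \<bar>x - y\<bar> powr \<alpha>"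
    using hoelder_bddE[OF assms(1)] by metis
  obtain D \<beta> where D: "0 < \<beta>" "\<beta> \<le> 1" "0 \<le> D" "\<And>x. x \<in> S \<Longrightarrow> \<bar>g x\<bar> \<le> D"
    "\<And>x y. x \<in> S \<Longrightarrow> y \<in> S \<Longrightarrow> \<bar>g x - g y\<bar> \<le> D * \<bar>x - y\<bar> powr \<beta>"
    using hoelder_bddE[OF assms(2)] by metis
  define \<gamma> where "\<gamma> = min \<alpha> \<beta>"
  define E where "E = 2 * (C + D)"
  have g: "0 < \<gamma>" "\<gamma> \<le> 1" "\<gamma> \<le> \<alpha>" "\<gamma> \<le> \<beta>" using C D by (auto simp: \<gamma>_def)
  show thesis
  proof (rule that[of \<gamma> E])
    show "0 \<le> E" using C D by (simp add: E_def)
    show "\<bar>f x\<bar> \<le> E" if "x \<in> S" for x using C(3) D(3) C(4)[OF that] by (simp add: E_def)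
    show "\<bar>g x\<bar> \<le> E" if "x \<in> S" for x using C(3) D(3) D(4)[OF that] by (simp add: E_def)
    show "\<bar>f x - f y\<bar> \<le> E * \<bar>x - y\<bar> powr \<gamma>" if s: "x \<in> S" "y \<in> S" for x y
    proof -
      have "\<bar>f x - f y\<bar> \<le> 2 * C * \<bar>x - y\<bar> powr \<gamma>"
        by (rule hoelder_lower_exponent[OF g(1,3) C(3)]) (use C(4)[OF s(1)] C(4)[OF s(2)] C(5)[OF s] in auto)
      also have "\<dots> \<le> E * \<bar>x - y\<bar> powr \<gamma>"
        using D(3) by (intro mult_right_mono) (auto simp: E_def)
      finally show ?thesis .
    qed
    show "\<bar>g x - g y\<bar> \<le> E * \<bar>x - y\<bar> powr \<gamma>" if s: "x \<in> S" "y \<in> S" for x y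
    proof -
      have "\<bar>g x - g y\<bar> \<le> 2 * D * \<bar>x - y\<bar> powr \<gamma>"
        by (rule hoelder_lower_exponent[OF g(1,4) D(3)]) (use D(4)[OF s(1)] D(4)[OF s(2)] D(5)[OF s] in auto)
      also have "\<dots> \<le> E * \<bar>x - y\<bar> powr \<gamma>"
        using C(3) by (intro mult_right_mono) (auto simp: E_def)
      finally show ?thesis .
    qed
  qed (use g in auto)
qed

lemma hoelder_bdd_add:
  assumes "hoelder_bdd S f" "hoelder_bdd S g"
  shows "hoelder_bdd S (\<lambda>x. f x + g x)"
proof -
  obtain C \<alpha> where C: "0 < \<alpha>" "\<alpha> \<le> 1" "0 \<le> C"
    "\<And>x. x \<in> S \<Longrightarrow> \<bar>f x\<bar> \<le> C" "\<And>x. x \<in> S \<Longrightarrow> \<bar>g x\<bar> \<le> C"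
    "\<And>x y. x \<in> S \<Longrightarrow> y \<in> S \<Longrightarrow> \<bar>f x - f y\<bar> \<le> C * \<bar>x - y\<bar> powr \<alpha>"
    "\<And>x y. x \<in> S \<Longrightarrow> y \<in> S \<Longrightarrow> \<bar>g x - g y\<bar> \<le> C * \<bar>x - y\<bar> powr \<alpha>"
    using hoelder_bddE_pair[OF assms] by metis
  show ?thesis
  proof (rule hoelder_bddI[where C = "2 * C" and \<alpha> = \<alpha>])
    show "\<bar>f x + g x\<bar> \<le> 2 * C" if "x \<in> S" for x using C(4)[OF that] C(5)[OF that] by linarith
    show "\<bar>f x + g x - (f y + g y)\<bar> \<le> 2 * C * \<bar>x - y\<bar> powr \<alpha>" if "x \<in> S" "y \<in> S" for x y
      using C(6)[OF that] C(7)[OF that] by linarith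
  qed (use C in auto)
qed

lemma hoelder_bdd_mult:
  assumes "hoelder_bdd S f" "hoelder_bdd S g"
  shows "hoelder_bdd S (\<lambda>x. f x * g x)"
proof -
  obtain C \<alpha> where C: "0 < \<alpha>" "\<alpha> \<le> 1" "0 \<le> C"
    "\<And>x. x \<in> S \<Longrightarrow> \<bar>f x\<bar> \<le> C" "\<And>x. x \<in> S \<Longrightarrow> \<bar>g x\<bar> \<le> C"
    "\<And>x y. x \<in> S \<Longrightarrow> y \<in> S \<Longrightarrow> \<bar>f x - f y\<bar> \<le> C * \<bar>x - y\<bar> powr \<alpha>"
    "\<And>x y. x \<in> S \<Longrightarrow> y \<in> S \<Longrightarrow> \<bar>g x - g y\<bar> \<le> C * \<bar>x - y\<bar> powr \<alpha>"
    using hoelder_bddE_pair[OF assms] by metis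
  show ?thesis
  proof (rule hoelder_bddI[where C = "2 * C * C" and \<alpha> = \<alpha>])
    show "\<bar>f x * g x\<bar> \<le> 2 * C * C" if "x \<in> S" for x
    proof -
      have "\<bar>f x * g x\<bar> \<le> C * C"
        unfolding abs_mult by (intro mult_mono C that) (use C in auto)
      also have "\<dots> \<le> 2 * C * C" using C(3) by simp
      finally show ?thesis .
    qed
    show "\<bar>f x * g x - f y * g y\<bar> \<le> 2 * C * C * \<bar>x - y\<bar> powr \<alpha>" if s: "x \<in> S" "y \<in> S" for x y
    proof -
      have "f x * g x - f y * g y = f x * (g x - g y) + (f x - f y) * g y"
        by (simp add: algebra_simps)
      then have "\<bar>f x * g x - f y * g y\<bar> \<le> \<bar>f x\<bar> * \<bar>g x - g y\<bar> + \<bar>f x - f y\<bar> * \<bar>g y\<bar>"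
        by (metis abs_mult abs_triangle_ineq)
      also have "\<bar>f x\<bar> * \<bar>g x - g y\<bar> \<le> C * (C * \<bar>x - y\<bar> powr \<alpha>)"
        by (intro mult_mono C s) (use C in auto)
      also have "\<bar>f x - f y\<bar> * \<bar>g y\<bar> \<le> (C * \<bar>x - y\<bar> powr \<alpha>) * C"
        by (intro mult_mono C s) (use C in auto)
      finally show ?thesis by (simp add: algebra_simps)
    qed
  qed (use C in auto)
qed

lemma hoelder_bdd_const: "hoelder_bdd S (\<lambda>x. c)"
  unfolding hoelder_bdd_def by (intro exI[of _ "\<bar>c\<bar>"] exI[of _ 1]) auto

lemma hoelder_bdd_subset: "hoelder_bdd S f \<Longrightarrow> T \<subseteq> S \<Longrightarrow> hoelder_bdd T f"
  unfolding hoelder_bdd_def by (meson subsetD)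

lemma hoelder_bdd_cong: "(\<And>x. x \<in> S \<Longrightarrow> f x = g x) \<Longrightarrow> hoelder_bdd S f \<longleftrightarrow> hoelder_bdd S g"
  unfolding hoelder_bdd_def by simp

lemma hoelder_bdd_shift:
  assumes "hoelder_bdd S' f" "\<And>x. x \<in> S \<Longrightarrow> x + c \<in> S'"
  shows "hoelder_bdd S (\<lambda>x. f (x + c))"
proof -
  obtain C \<alpha> where C: "0 < \<alpha>" "\<alpha> \<le> 1" "\<And>x. x \<in> S' \<Longrightarrow> \<bar>f x\<bar> \<le> C"
    "\<And>x y. x \<in> S' \<Longrightarrow> y \<in> S' \<Longrightarrow> \<bar>f x - f y\<bar> \<le> C * \<bar>x - y\<bar> powr \<alpha>"
    using hoelder_bddE[OF assms(1)] by metis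
  show ?thesis
  proof (rule hoelder_bddI[where C = C and \<alpha> = \<alpha>])
    show "\<bar>f (x + c) - f (y + c)\<bar> \<le> C * \<bar>x - y\<bar> powr \<alpha>" if "x \<in> S" "y \<in> S" for x y
      using C(4)[OF assms(2)[OF that(1)] assms(2)[OF that(2)]] by simp
  qed (use C assms(2) in auto)
qed

lemma hoelder_bdd_lipschitz:
  assumes "\<And>x. x \<in> S \<Longrightarrow> \<bar>f x\<bar> \<le> B" "\<And>x y. x \<in> S \<Longrightarrow> y \<in> S \<Longrightarrow> \<bar>f x - f y\<bar> \<le> K * \<bar>x - y\<bar>"
  shows "hoelder_bdd S f"
proof (rule hoelder_bddI[where C = "max B K" and \<alpha> = 1])
  show "\<bar>f x\<bar> \<le> max B K" if "x \<in> S" for x using assms(1)[OF that] by simp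
  show "\<bar>f x - f y\<bar> \<le> max B K * \<bar>x - y\<bar> powr 1" if "x \<in> S" "y \<in> S" for x y
  proof -
    have "K * \<bar>x - y\<bar> \<le> max B K * \<bar>x - y\<bar>" by (intro mult_right_mono) auto
    then show ?thesis using assms(2)[OF that] by simp
  qed
qed auto

lemma hoelder_bdd_deriv_bounded:
  assumes "convex S" "\<And>x. x \<in> S \<Longrightarrow> \<bar>f x\<bar> \<le> B"
    "\<And>x. x \<in> S \<Longrightarrow> (f has_real_derivative f' x) (at x)" "\<And>x. x \<in> S \<Longrightarrow> \<bar>f' x\<bar> \<le> K"
  shows "hoelder_bdd S f"
proof (rule hoelder_bdd_lipschitz[OF assms(2)])
  show "\<bar>f x - f y\<bar> \<le> K * \<bar>x - y\<bar>" if "x \<in> S" "y \<in> S" for x y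
    using field_differentiable_bound[OF assms(1), of f f' K x y] assms(3,4) that
    by (auto intro: has_field_derivative_at_within)
qed

lemma hoelder_C_bdd: "hoelder_C n S f \<Longrightarrow> hoelder_bdd S f"
  by (cases n) auto

lemma hoelder_C_SucD: "hoelder_C (Suc n) S f \<Longrightarrow> hoelder_C n S f"
  by (induction n arbitrary: f) auto

lemma hoelder_C_mono: "m \<le> n \<Longrightarrow> hoelder_C n S f \<Longrightarrow> hoelder_C m S f"
  by (induction n rule: dec_induct) (auto dest: hoelder_C_SucD simp del: hoelder_C.simps)

lemma hoelder_C_SucI:
  assumes "hoelder_bdd S f" "\<And>x. x \<in> S \<Longrightarrow> (f has_real_derivative f' x) (at x)" "hoelder_C n S f'"
  shows "hoelder_C (Suc n) S f"
  using assms by auto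

lemma hoelder_C_SucE:
  assumes "hoelder_C (Suc n) S f"
  obtains f' where "\<And>x. x \<in> S \<Longrightarrow> (f has_real_derivative f' x) (at x)" "hoelder_C n S f'"
  using assms by auto

lemma hoelder_C_cong:
  assumes "open S" "\<And>x. x \<in> S \<Longrightarrow> f x = g x" "hoelder_C n S f"
  shows "hoelder_C n S g"
proof (cases n)
  case 0
  then show ?thesis using assms hoelder_bdd_cong[of S f g] by simp
next
  case (Suc m)
  have "(g has_real_derivative D) (at x)" if "x \<in> S" "(f has_real_derivative D) (at x)" for x D
    using has_field_derivative_transform_within_open[OF that(2) assms(1) that(1)] assms(2) by auto
  then show ?thesis using assms(3) hoelder_bdd_cong[of S f g] assms(2) unfolding Suc by simp blast
qed

lemma hoelder_C_const: "hoelder_C n S (\<lambda>x. c)"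
proof (induction n arbitrary: c)
  case (Suc n)
  show ?case
    by (rule hoelder_C_SucI[OF hoelder_bdd_const, where f' = "\<lambda>x. 0"]) (use Suc in auto)
qed (simp add: hoelder_bdd_const)

lemma hoelder_C_add:
  "hoelder_C n S f \<Longrightarrow> hoelder_C n S g \<Longrightarrow> hoelder_C n S (\<lambda>x. f x + g x)"
proof (induction n arbitrary: f g)
  case (Suc n)
  obtain f' where f': "\<And>x. x \<in> S \<Longrightarrow> (f has_real_derivative f' x) (at x)" "hoelder_C n S f'"
    using hoelder_C_SucE[OF Suc.prems(1)] by blast
  obtain g' where g': "\<And>x. x \<in> S \<Longrightarrow> (g has_real_derivative g' x) (at x)" "hoelder_C n S g'"
    using hoelder_C_SucE[OF Suc.prems(2)] by blast
  show ?case
    by (rule hoelder_C_SucI[where f' = "\<lambda>x. f' x + g' x"])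
      (use f' g' Suc in \<open>auto intro: hoelder_bdd_add DERIV_add\<close>)
qed (simp add: hoelder_bdd_add)

lemma hoelder_C_mult:
  "hoelder_C n S f \<Longrightarrow> hoelder_C n S g \<Longrightarrow> hoelder_C n S (\<lambda>x. f x * g x)"
proof (induction n arbitrary: f g)
  case (Suc n)
  obtain f' where f': "\<And>x. x \<in> S \<Longrightarrow> (f has_real_derivative f' x) (at x)" "hoelder_C n S f'"
    using hoelder_C_SucE[OF Suc.prems(1)] by blast
  obtain g' where g': "\<And>x. x \<in> S \<Longrightarrow> (g has_real_derivative g' x) (at x)" "hoelder_C n S g'"
    using hoelder_C_SucE[OF Suc.prems(2)] by blast
  show ?case
  proof (rule hoelder_C_SucI[where f' = "\<lambda>x. f' x * g x + g' x * f x"])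
    show "hoelder_bdd S (\<lambda>x. f x * g x)" using Suc.prems by (auto intro: hoelder_bdd_mult)
    show "hoelder_C n S (\<lambda>x. f' x * g x + g' x * f x)"
      using Suc.IH f'(2) g'(2) hoelder_C_SucD[OF Suc.prems(1)] hoelder_C_SucD[OF Suc.prems(2)]
      by (intro hoelder_C_add) auto
  qed (use f' g' in \<open>auto intro: DERIV_mult\<close>)
qed (simp add: hoelder_bdd_mult)

lemma hoelder_C_cmult: "hoelder_C n S f \<Longrightarrow> hoelder_C n S (\<lambda>x. c * f x)"
  using hoelder_C_mult[OF hoelder_C_const] .

lemma hoelder_C_diff:
  assumes "hoelder_C n S f" "hoelder_C n S g"
  shows "hoelder_C n S (\<lambda>x. f x - g x)"
  using hoelder_C_add[OF assms(1) hoelder_C_cmult[OF assms(2), of "-1"]] by simp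

lemma hoelder_C_shift:
  assumes "\<And>x. x \<in> S \<Longrightarrow> x + c \<in> S'"
  shows "hoelder_C n S' f \<Longrightarrow> hoelder_C n S (\<lambda>x. f (x + c))"
proof (induction n arbitrary: f)
  case (Suc n)
  obtain f' where f': "\<And>x. x \<in> S' \<Longrightarrow> (f has_real_derivative f' x) (at x)" "hoelder_C n S' f'"
    using hoelder_C_SucE[OF Suc.prems] by blast
  show ?case
  proof (rule hoelder_C_SucI[where f' = "\<lambda>x. f' (x + c)"])
    show "hoelder_bdd S (\<lambda>x. f (x + c))" using Suc.prems assms by (auto intro: hoelder_bdd_shift)
    show "((\<lambda>x. f (x + c)) has_real_derivative f' (x + c)) (at x)" if "x \<in> S" for x
      using f'(1)[OF assms[OF that]] by (simp add: DERIV_shift)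
  qed (use Suc f' in auto)
qed (use assms in \<open>auto intro: hoelder_bdd_shift\<close>)

lemma hoelder_C_deriv:
  assumes "open S" "hoelder_C (Suc n) S f"
  shows "hoelder_C n S (deriv f)"
proof -
  obtain f' where f': "\<And>x. x \<in> S \<Longrightarrow> (f has_real_derivative f' x) (at x)" "hoelder_C n S f'"
    using hoelder_C_SucE[OF assms(2)] by blast
  have "f' x = deriv f x" if "x \<in> S" for x
    using DERIV_imp_deriv[OF f'(1)[OF that]] by simp
  from hoelder_C_cong[OF assms(1) this f'(2)] show ?thesis .
qed

lemma hoelder_C_higher_deriv:
  assumes "open S"
  shows "hoelder_C n S f \<Longrightarrow> j < n \<Longrightarrow> x \<in> S \<Longrightarrow>
    ((deriv ^^ j) f has_real_derivative (deriv ^^ Suc j) f x) (at x)"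
proof (induction n arbitrary: f j)
  case (Suc n)
  obtain f' where f': "\<And>x. x \<in> S \<Longrightarrow> (f has_real_derivative f' x) (at x)" "hoelder_C n S f'"
    using hoelder_C_SucE[OF Suc.prems(1)] by blast
  have d: "f' x = deriv f x" if "x \<in> S" for x
    using DERIV_imp_deriv[OF f'(1)[OF that]] by simp
  show ?case
  proof (cases j)
    case 0
    then show ?thesis using f'(1)[OF Suc.prems(3)] d[OF Suc.prems(3)] by simp
  next
    case (Suc i)
    have "hoelder_C n S (deriv f)"
      by (rule hoelder_C_deriv[OF assms Suc.prems(1)])
    then have "((deriv ^^ i) (deriv f) has_real_derivative (deriv ^^ Suc i) (deriv f) x) (at x)"
      using Suc.IH Suc Suc.prems by auto
    then show ?thesis by (simp only: Suc funpow_Suc_right comp_def)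
  qed
qed simp

text \<open>The part |x - y| \<le> d of the principal value integral of f y / (x - y). Pairing x - t
  with x + t turns the principal value into an absolutely convergent integral for Hoelder f.\<close>

definition near_hilbert :: "real \<Rightarrow> (real \<Rightarrow> real) \<Rightarrow> real \<Rightarrow> real" where
  "near_hilbert d f x = (LBINT t:{0<..d}. (f (x - t) - f (x + t)) / t)"

lemma hoelder_bdd_continuous_on:
  assumes "hoelder_bdd S f"
  shows "continuous_on S f"
proof -
  obtain C \<alpha> where C: "0 < \<alpha>" "0 \<le> C"
    "\<And>x y. x \<in> S \<Longrightarrow> y \<in> S \<Longrightarrow> \<bar>f x - f y\<bar> \<le> C * \<bar>x - y\<bar> powr \<alpha>"
    using hoelder_bddE[OF assms] by metis
  have "(f \<longlongrightarrow> f x) (at x within S)" if x: "x \<in> S" for x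
  proof -
    have "((\<lambda>y. C * \<bar>y - x\<bar> powr \<alpha>) \<longlongrightarrow> C * \<bar>x - x\<bar> powr \<alpha>) (at x within S)"
      by (intro tendsto_intros) (use C in auto)
    then have l: "((\<lambda>y. C * \<bar>y - x\<bar> powr \<alpha>) \<longlongrightarrow> 0) (at x within S)" by simp
    have "((\<lambda>y. f y - f x) \<longlongrightarrow> 0) (at x within S)"
      by (rule Lim_null_comparison[OF _ l]) (use C(3)[OF _ x] in \<open>auto simp: eventually_at_filter\<close>)
    then show ?thesis by (simp add: LIM_zero_iff)
  qed
  then show ?thesis by (simp add: continuous_on_def)
qed

section \<open>The truncated Hilbert transform on a set whose d-neighbourhood lies in S'\<close>

context
  fixes S S' :: "real set" and d :: real
  assumes S: "\<And>x t. x \<in> S \<Longrightarrow> \<bar>t\<bar> \<le> d \<Longrightarrow> x + t \<in> S'" and d: "d > 0"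
begin

lemma symmetric_diff_quotient_bound:
  assumes "0 < \<alpha>" "\<alpha> \<le> 1" "0 \<le> C"
    "\<And>x y. x \<in> S' \<Longrightarrow> y \<in> S' \<Longrightarrow> \<bar>f x - f y\<bar> \<le> C * \<bar>x - y\<bar> powr \<alpha>"
    and x: "x \<in> S" and t: "t \<in> {0<..d}"
  shows "\<bar>(f (x - t) - f (x + t)) / t\<bar> \<le> 2 * C * t powr (\<alpha> - 1)"
proof -
  have "x - t \<in> S'" "x + t \<in> S'" using S[OF x, of t] S[OF x, of "-t"] t by auto
  then have "\<bar>f (x - t) - f (x + t)\<bar> \<le> C * \<bar>x - t - (x + t)\<bar> powr \<alpha>" by (rule assms)
  also have "\<bar>x - t - (x + t)\<bar> = 2 * t" using t by simp
  also have "(2 * t) powr \<alpha> = 2 powr \<alpha> * t powr \<alpha>" using t by (simp add: powr_mult)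
  also have "C * \<dots> \<le> C * (2 powr 1 * t powr \<alpha>)"
    using assms by (intro mult_left_mono mult_right_mono powr_mono) auto
  finally have "\<bar>f (x - t) - f (x + t)\<bar> \<le> 2 * C * t powr \<alpha>" by simp
  then have "\<bar>f (x - t) - f (x + t)\<bar> / t \<le> 2 * C * t powr \<alpha> / t"
    using t by (intro divide_right_mono) auto
  then show ?thesis using t by (simp add: abs_divide powr_diff)
qed

lemma near_hilbert_integrable:
  assumes f: "hoelder_bdd S' f" and x: "x \<in> S"
  shows "set_integrable lborel {0<..d} (\<lambda>t. (f (x - t) - f (x + t)) / t)"
proof -
  obtain C \<alpha> where C: "0 < \<alpha>" "\<alpha> \<le> 1" "0 \<le> C"
    "\<And>x y. x \<in> S' \<Longrightarrow> y \<in> S' \<Longrightarrow> \<bar>f x - f y\<bar> \<le> C * \<bar>x - y\<bar> powr \<alpha>"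
    using hoelder_bddE[OF f] by metis
  show ?thesis
  proof (rule set_integrable_continuous_dominated)
    show "set_integrable lborel {0<..d} (\<lambda>t. 2 * C * t powr (\<alpha> - 1))"
      using C d by (intro set_integrable_mult_right set_integrable_powr_Ioc) auto
    have in_S': "x - t \<in> S'" "x + t \<in> S'" if "t \<in> {0<..d}" for t
      using S[OF x, of "-t"] S[OF x, of t] that by auto
    show "continuous_on {0<..d} (\<lambda>t. (f (x - t) - f (x + t)) / t)"
      by (intro continuous_intros continuous_on_compose2[OF hoelder_bdd_continuous_on[OF f]] image_subsetI in_S') auto
  qed (use symmetric_diff_quotient_bound[OF C x] in auto)
qed

text \<open>The integrands at x and y differ by at most a multiple of
  \<open>t powr (\<alpha> - 1)\<close>, which shows no smallness in x - y, and of
  \<open>\<bar>x - y\<bar> powr \<alpha> / t\<close>, which is not integrable at 0. Their geometric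
  mean has both virtues and leaves the exponent \<alpha> / 2.\<close>

lemma hoelder_bdd_near_hilbert:
  assumes f: "hoelder_bdd S' f"
  shows "hoelder_bdd S (near_hilbert d f)"
proof -
  obtain C \<alpha> where C: "0 < \<alpha>" "\<alpha> \<le> 1" "0 \<le> C"
    "\<And>x y. x \<in> S' \<Longrightarrow> y \<in> S' \<Longrightarrow> \<bar>f x - f y\<bar> \<le> C * \<bar>x - y\<bar> powr \<alpha>"
    using hoelder_bddE[OF f] by metis
  define I where "I = (LBINT t:{0<..d}. 2 * C * t powr (\<alpha> - 1))"
  define J where "J = (LBINT t:{0<..d}. 4 * C * t powr (\<alpha> / 2 - 1))"
  have ig: "set_integrable lborel {0<..d} (\<lambda>t. K * t powr (p - 1))" if "p > 0" for K p
    using that d by (intro set_integrable_mult_right set_integrable_powr_Ioc) auto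
  have b1: "\<bar>near_hilbert d f x\<bar> \<le> I" if x: "x \<in> S" for x
    unfolding near_hilbert_def I_def
    by (rule set_integral_abs_le[OF near_hilbert_integrable[OF f x] ig symmetric_diff_quotient_bound[OF C x]])
      (use C in auto)
  have b2: "\<bar>near_hilbert d f x - near_hilbert d f y\<bar> \<le> J * \<bar>x - y\<bar> powr (\<alpha> / 2)"
    if x: "x \<in> S" and y: "y \<in> S" for x y
  proof -
    let ?q = "\<lambda>x t. (f (x - t) - f (x + t)) / t"
    have "\<bar>LBINT t:{0<..d}. ?q x t - ?q y t\<bar>
        \<le> (LBINT t:{0<..d}. \<bar>x - y\<bar> powr (\<alpha> / 2) * (4 * C * t powr (\<alpha> / 2 - 1)))"
    proof (rule set_integral_abs_le)
      show "set_integrable lborel {0<..d} (\<lambda>t. ?q x t - ?q y t)"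
        by (intro set_integral_diff near_hilbert_integrable f x y)
      show "set_integrable lborel {0<..d} (\<lambda>t. \<bar>x - y\<bar> powr (\<alpha> / 2) * (4 * C * t powr (\<alpha> / 2 - 1)))"
        by (rule set_integrable_mult_right, rule ig) (use C in auto)
      fix t assume t: "t \<in> {0<..d}"
      have i: "x - t \<in> S'" "x + t \<in> S'" "y - t \<in> S'" "y + t \<in> S'"
        using S[OF x, of t] S[OF x, of "-t"] S[OF y, of t] S[OF y, of "-t"] t by auto
      let ?e = "\<bar>?q x t - ?q y t\<bar>"
      have "?e \<le> 2 * (2 * C * t powr (\<alpha> - 1))"
        using symmetric_diff_quotient_bound[OF C x t] symmetric_diff_quotient_bound[OF C y t] by linarith
      then have e1: "?e \<le> 4 * C * t powr (\<alpha> - 1)" by simp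
      have "\<bar>(f (x - t) - f (x + t)) - (f (y - t) - f (y + t))\<bar> \<le> 2 * (C * \<bar>x - y\<bar> powr \<alpha>)"
        using C(4)[OF i(1,3)] C(4)[OF i(2,4)] by simp
      then have "\<bar>(f (x - t) - f (x + t)) - (f (y - t) - f (y + t))\<bar> / t \<le> 2 * (C * \<bar>x - y\<bar> powr \<alpha>) / t"
        using t by (intro divide_right_mono) auto
      then have "?e \<le> 2 * (C * \<bar>x - y\<bar> powr \<alpha>) / t"
        using t by (simp add: diff_divide_distrib[symmetric])
      also have "\<dots> \<le> 4 * C * \<bar>x - y\<bar> powr \<alpha> * t powr -1"
        using t C(3) by (simp add: powr_minus divide_simps)
      finally have e2: "?e \<le> 4 * C * \<bar>x - y\<bar> powr \<alpha> * t powr -1" .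
      \<comment> \<open>Multiplying the two bounds gives an exact square, whose root is the
        geometric mean.\<close>
      have "?e * ?e \<le> (4 * C * t powr (\<alpha> - 1)) * (4 * C * \<bar>x - y\<bar> powr \<alpha> * t powr -1)"
        using e1 e2 C by (intro mult_mono) auto
      also have "\<dots> = (\<bar>x - y\<bar> powr (\<alpha> / 2) * (4 * C * t powr (\<alpha> / 2 - 1)))\<^sup>2"
      proof -
        have "t powr (\<alpha> - 1) * t powr -1 = t powr (\<alpha> / 2 - 1) * t powr (\<alpha> / 2 - 1)"
          by (simp only: powr_add[symmetric]) simp
        moreover have "\<bar>x - y\<bar> powr \<alpha> = \<bar>x - y\<bar> powr (\<alpha> / 2) * \<bar>x - y\<bar> powr (\<alpha> / 2)"
          by (simp add: powr_add[symmetric])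
        ultimately show ?thesis by algebra
      qed
      finally have "?e\<^sup>2 \<le> (\<bar>x - y\<bar> powr (\<alpha> / 2) * (4 * C * t powr (\<alpha> / 2 - 1)))\<^sup>2"
        by (simp add: power2_eq_square)
      then show "?e \<le> \<bar>x - y\<bar> powr (\<alpha> / 2) * (4 * C * t powr (\<alpha> / 2 - 1))"
        by (rule power2_le_imp_le) (use C in auto)
    qed
    then show ?thesis
      using near_hilbert_integrable[OF f x] near_hilbert_integrable[OF f y]
      by (simp add: near_hilbert_def J_def mult.commute)
  qed
  show ?thesis
  proof (rule hoelder_bddI[where C = "max I J" and \<alpha> = "\<alpha> / 2"])
    show "\<bar>near_hilbert d f x\<bar> \<le> max I J" if "x \<in> S" for x using b1[OF that] by simp
    show "\<bar>near_hilbert d f x - near_hilbert d f y\<bar> \<le> max I J * \<bar>x - y\<bar> powr (\<alpha> / 2)"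
      if "x \<in> S" "y \<in> S" for x y
    proof -
      have "J * \<bar>x - y\<bar> powr (\<alpha> / 2) \<le> max I J * \<bar>x - y\<bar> powr (\<alpha> / 2)"
        by (intro mult_right_mono) auto
      then show ?thesis using b2[OF that] by linarith
    qed
  qed (use C in auto)
qed

text \<open>The Hoelder seminorm of \<open>f'\<close> supplies the integrable majorant; mere
  boundedness of \<open>f'\<close> would leave 1 / t.\<close>

lemma near_hilbert_deriv:
  assumes "open S" and f: "hoelder_bdd S' f" and f': "hoelder_bdd S' f'"
    and der: "\<And>x. x \<in> S' \<Longrightarrow> (f has_real_derivative f' x) (at x)" and x: "x \<in> S"
  shows "(near_hilbert d f has_real_derivative near_hilbert d f' x) (at x)"
proof -
  obtain C \<alpha> where C: "0 < \<alpha>" "\<alpha> \<le> 1" "0 \<le> C"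
    "\<And>x y. x \<in> S' \<Longrightarrow> y \<in> S' \<Longrightarrow> \<bar>f' x - f' y\<bar> \<le> C * \<bar>x - y\<bar> powr \<alpha>"
    using hoelder_bddE[OF f'] by metis
  obtain e where e: "e > 0" "\<And>y. \<bar>y - x\<bar> < e \<Longrightarrow> y \<in> S"
    using openE[OF assms(1) x] by (auto simp: ball_def dist_real_def subset_iff abs_minus_commute)
  show ?thesis
    unfolding near_hilbert_def
  proof (rule has_real_derivative_set_integral_dominated[OF e(1)])
    show "set_integrable lborel {0<..d} (\<lambda>t. (f (y - t) - f (y + t)) / t)" if "\<bar>y - x\<bar> < e" for y
      by (rule near_hilbert_integrable[OF f e(2)[OF that]])
    show "set_integrable lborel {0<..d} (\<lambda>t. 2 * C * t powr (\<alpha> - 1))"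
      using C d by (intro set_integrable_mult_right set_integrable_powr_Ioc) auto
    fix y t assume y: "\<bar>y - x\<bar> < e" and t: "t \<in> {0<..d}"
    show "\<bar>(f' (y - t) - f' (y + t)) / t\<bar> \<le> 2 * C * t powr (\<alpha> - 1)"
      by (rule symmetric_diff_quotient_bound[OF C e(2)[OF y] t])
    have "y + t \<in> S'" "y + - t \<in> S'" using S[OF e(2)[OF y], of t] S[OF e(2)[OF y], of "-t"] t by auto
    from der[OF this(1)] der[OF this(2)]
    have "((\<lambda>y. f (y + t)) has_real_derivative f' (y + t)) (at y)"
      "((\<lambda>y. f (y + - t)) has_real_derivative f' (y + - t)) (at y)"
      by (simp_all only: DERIV_shift)
    then have "((\<lambda>y. f (y - t) - f (y + t)) has_real_derivative f' (y - t) - f' (y + t)) (at y)"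
      by (intro DERIV_diff) simp_all
    then show "((\<lambda>y. (f (y - t) - f (y + t)) / t) has_real_derivative (f' (y - t) - f' (y + t)) / t) (at y)"
      by (rule DERIV_cdivide)
  qed
qed

lemma hoelder_C_near_hilbert:
  assumes "open S"
  shows "hoelder_C n S' f \<Longrightarrow> hoelder_C n S (near_hilbert d f)"
proof (induction n arbitrary: f)
  case (Suc n)
  obtain f' where f': "\<And>x. x \<in> S' \<Longrightarrow> (f has_real_derivative f' x) (at x)" "hoelder_C n S' f'"
    using hoelder_C_SucE[OF Suc.prems] by blast
  show ?case
  proof (rule hoelder_C_SucI)
    show "(near_hilbert d f has_real_derivative near_hilbert d f' x) (at x)" if "x \<in> S" for x
      by (rule near_hilbert_deriv[OF assms _ _ f'(1) that])
        (use Suc.prems f' hoelder_C_bdd in blast)+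
  qed (use Suc f' hoelder_C_bdd[OF Suc.prems] in \<open>auto intro: hoelder_bdd_near_hilbert\<close>)
qed (simp add: hoelder_bdd_near_hilbert)

end

section \<open>Profiles\<close>

text \<open>The last two assumptions carry the convexity of s -> w (sqrt s): chords starting at s
  have slope at least -1, and at least -1 / s.\<close>

locale profile =
  fixes w :: "real \<Rightarrow> real"
  assumes w_cont: "continuous_on UNIV w"
    and w_even: "w (- x) = w x"
    and w_nonneg: "0 \<le> w x"
    and w_le_1: "w x \<le> 1"
    and w_antimono: "0 \<le> x \<Longrightarrow> x \<le> y \<Longrightarrow> w y \<le> w x"
    and w_diff: "0 \<le> x \<Longrightarrow> x \<le> y \<Longrightarrow> w x - w y \<le> y\<^sup>2 - x\<^sup>2"
    and w_diff_far: "0 < x \<Longrightarrow> x \<le> y \<Longrightarrow> w x - w y \<le> (y\<^sup>2 - x\<^sup>2) / x\<^sup>2"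
begin

lemma w_abs: "w \<bar>x\<bar> = w x"
  by (cases "x \<ge> 0") (auto simp: w_even)

lemma w_isCont: "isCont w x"
  using w_cont by (simp add: continuous_on_eq_continuous_at)

lemma continuous_on_w: "continuous_on A f \<Longrightarrow> continuous_on A (\<lambda>t. w (f t))"
  by (rule continuous_on_compose2[OF w_cont]) auto

text \<open>For x < 1 and y \<le> 2 the slope bound -1 in the variable x^2 suffices, and for x \<ge>
  1 and y \<le> 2 * x the bound -1 / x^2. Otherwise y - x \<ge> 1, and the oscillation of w is at
  most 1.\<close>

lemma w_lipschitz_nonneg:
  assumes "0 \<le> x" "x \<le> y"
  shows "w x - w y \<le> 3 * (y - x)"
proof -
  have one: "w x - w y \<le> 1" using w_le_1[of x] w_nonneg[of y] by simp
  have fac: "y\<^sup>2 - x\<^sup>2 = (y - x) * (y + x)" by (simp add: power2_eq_square algebra_simps)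
  consider "x < 1" "y \<le> 2" | "x < 1" "y > 2" | "x \<ge> 1" "y \<le> 2 * x" | "x \<ge> 1" "y > 2 * x"
    by linarith
  then show ?thesis
  proof cases
    case 1
    have "w x - w y \<le> (y - x) * (y + x)" using w_diff[OF assms] fac by simp
    also have "\<dots> \<le> (y - x) * 3" using 1 assms by (intro mult_left_mono) auto
    finally show ?thesis by simp
  next
    case 3
    have "w x - w y \<le> (y - x) * (y + x) / x\<^sup>2" using w_diff_far[of x y] 3 assms fac by simp
    also have "\<dots> \<le> (y - x) * (3 * x) / x\<^sup>2"
      using 3 assms by (intro divide_right_mono mult_left_mono) auto
    also have "\<dots> = (y - x) * (3 / x)" using 3 by (simp add: power2_eq_square)
    also have "\<dots> \<le> (y - x) * 3" using 3 assms by (intro mult_left_mono) (auto simp: field_simps)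
    finally show ?thesis by simp
  next
    case 2
    then have "1 \<le> 3 * (y - x)" by simp
    then show ?thesis using one by simp
  next
    case 4
    then have "1 \<le> 3 * (y - x)" by simp
    then show ?thesis using one by simp
  qed
qed

lemma w_lipschitz: "\<bar>w x - w y\<bar> \<le> 3 * \<bar>x - y\<bar>"
proof -
  have *: "\<bar>w a - w b\<bar> \<le> 3 * (b - a)" if "0 \<le> a" "a \<le> b" for a b
    using w_lipschitz_nonneg[OF that] w_antimono[OF that] by simp
  have "\<bar>w \<bar>x\<bar> - w \<bar>y\<bar>\<bar> \<le> 3 * \<bar>\<bar>x\<bar> - \<bar>y\<bar>\<bar>"
    using *[of "\<bar>x\<bar>" "\<bar>y\<bar>"] *[of "\<bar>y\<bar>" "\<bar>x\<bar>"] by (cases "\<bar>x\<bar> \<le> \<bar>y\<bar>") (auto simp: abs_minus_commute)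
  also have "\<dots> \<le> 3 * \<bar>x - y\<bar>" by (simp add: abs_triangle_ineq3)
  finally show ?thesis unfolding w_abs .
qed

lemma hoelder_bdd_w: "hoelder_bdd S w"
  by (rule hoelder_bdd_lipschitz[of _ _ 1 3]) (use w_nonneg w_le_1 w_lipschitz in auto)

lemma w_sym_diff_nonneg:
  assumes "0 \<le> x" "0 \<le> t" shows "w (x + t) \<le> w (x - t)"
  using w_antimono[of "\<bar>x - t\<bar>" "x + t"] assms by (simp add: w_abs)

lemma w_sym_diff: "\<bar>w (x - t) - w (x + t)\<bar> \<le> 6 * \<bar>t\<bar>"
  using w_lipschitz[of "x - t" "x + t"] by simp

text \<open>Since t - x \<ge> t / 2, the slope bound -1 / s applies at s of size t^2. After division
  by t this is O(x / t^2), integrable at infinity although w need not decay.\<close>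

lemma w_sym_diff_far_pos:
  assumes "0 < t" "0 \<le> x" "2 * x \<le> t"
  shows "\<bar>w (x - t) - w (x + t)\<bar> \<le> 16 * x / t"
proof -
  have "w (t - x) - w (t + x) \<le> ((t + x)\<^sup>2 - (t - x)\<^sup>2) / (t - x)\<^sup>2"
    using assms by (intro w_diff_far) auto
  also have "\<dots> = 4 * t * x / (t - x)\<^sup>2" by (simp add: power2_eq_square algebra_simps)
  also have "\<dots> \<le> 4 * t * x / (t / 2)\<^sup>2"
    using assms by (intro divide_left_mono power_mono mult_pos_pos) auto
  also have "\<dots> = 16 * x / t" using assms by (simp add: power2_eq_square field_simps)
  finally have "w (t - x) - w (t + x) \<le> 16 * x / t" .
  moreover have "w (t - x) = w (x - t)" using w_even[of "t - x"] by simp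
  ultimately show ?thesis using w_sym_diff_nonneg[of x t] assms by (simp add: add.commute)
qed

lemma w_sym_diff_far:
  assumes "0 < t" "2 * \<bar>x\<bar> \<le> t"
  shows "\<bar>w (x - t) - w (x + t)\<bar> \<le> 16 * \<bar>x\<bar> / t"
proof (cases "x \<ge> 0")
  case False
  have "w (- x - t) = w (x + t)" "w (- x + t) = w (x - t)"
    using w_even[of "x + t"] w_even[of "x - t"] by simp_all
  then show ?thesis using w_sym_diff_far_pos[of t "- x"] assms False by (simp add: abs_minus_commute)
qed (use w_sym_diff_far_pos assms in auto)

text \<open>The same estimate with x and t exchanged when 2 * t \<le> x; otherwise the right side
  exceeds 1. Together with the far bound it is invariant under scaling of x and t, which makes
  \<open>hil\<close> bounded uniformly in x.\<close>

lemma w_sym_diff_near: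
  assumes "0 < t" "t \<le> 2 * x"
  shows "\<bar>w (x - t) - w (x + t)\<bar> \<le> 16 * t / x"
proof (cases "2 * t \<le> x")
  case True
  have "w (x - t) - w (x + t) \<le> ((x + t)\<^sup>2 - (x - t)\<^sup>2) / (x - t)\<^sup>2"
    using assms True by (intro w_diff_far) auto
  also have "\<dots> = 4 * t * x / (x - t)\<^sup>2" by (simp add: power2_eq_square algebra_simps)
  also have "\<dots> \<le> 4 * t * x / (x / 2)\<^sup>2"
    using assms True by (intro divide_left_mono power_mono mult_pos_pos) auto
  also have "\<dots> = 16 * t / x" using assms by (simp add: power2_eq_square field_simps)
  finally show ?thesis using w_sym_diff_nonneg[of x t] assms by simp
next
  case False
  have "\<bar>w (x - t) - w (x + t)\<bar> \<le> 1"
    using w_le_1[of "x - t"] w_nonneg[of "x + t"] w_le_1[of "x + t"] w_nonneg[of "x - t"] by linarith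
  also have "1 \<le> 16 * t / x" using False assms by (simp add: field_simps)
  finally show ?thesis .
qed

section \<open>The symmetric integral, its primitive and its lower bound\<close>

definition hil :: "real \<Rightarrow> real" where
  "hil x = (LBINT t:{0<..}. (w (x - t) - w (x + t)) / t)"

text \<open>A majorant valid for all |x| \<le> X at once, as differentiation under the integral
  requires. The 6 is twice the Lipschitz constant 3.\<close>

definition env :: "real \<Rightarrow> real \<Rightarrow> real" where
  "env X t = (if t \<le> 2 * X then 6 else 16 * X / t\<^sup>2)"

lemma env_integrable: "0 < X \<Longrightarrow> set_integrable lborel {0<..} (env X)"
  using set_integrable_piecewise(1)[of "2 * X" 6 "16 * X"] by (simp add: env_def[abs_def])

lemma env_bound:
  assumes "\<bar>x\<bar> \<le> X" "0 < X" "t \<in> {0<..}"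
  shows "\<bar>(w (x - t) - w (x + t)) / t\<bar> \<le> env X t"
proof (cases "t \<le> 2 * X")
  case True
  then show ?thesis using w_sym_diff[of x t] assms by (simp add: env_def field_simps)
next
  case False
  have "\<bar>w (x - t) - w (x + t)\<bar> \<le> 16 * \<bar>x\<bar> / t" using w_sym_diff_far[of t x] assms False by auto
  also have "\<dots> \<le> 16 * X / t" using assms by (intro divide_right_mono) auto
  finally have "\<bar>w (x - t) - w (x + t)\<bar> / t \<le> 16 * X / t / t"
    using assms by (intro divide_right_mono) auto
  then show ?thesis using False assms by (simp add: env_def power2_eq_square)
qed

lemma hil_integrable: "set_integrable lborel {0<..} (\<lambda>t. (w (x - t) - w (x + t)) / t)"
proof (rule set_integrable_continuous_dominated[OF env_integrable[of "\<bar>x\<bar> + 1"]])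
  show "continuous_on {0<..} (\<lambda>t. (w (x - t) - w (x + t)) / t)"
    by (intro continuous_intros continuous_on_w) auto
qed (use env_bound[of x "\<bar>x\<bar> + 1"] in auto)

lemma hil_odd: "hil (- x) = - hil x"
proof -
  have "(w (- x - t) - w (- x + t)) / t = - ((w (x - t) - w (x + t)) / t)" for t
    using w_even[of "x + t"] w_even[of "x - t"] by (simp add: diff_divide_distrib)
  then have "hil (- x) = (LBINT t:{0<..}. - ((w (x - t) - w (x + t)) / t))" by (simp only: hil_def)
  also have "\<dots> = - hil x" unfolding hil_def by (rule set_integral_uminus[OF hil_integrable])
  finally show ?thesis .
qed

text \<open>The majorant integrates to (16 / x) * 2 * x + 16 * x / (2 * x) = 32 + 8, independently
  of x.\<close>

lemma hil_bounded_pos: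
  assumes "x > 0" shows "\<bar>hil x\<bar> \<le> 40"
proof -
  have "\<bar>hil x\<bar> \<le> (LBINT t:{0<..}. if t \<le> 2 * x then 16 / x else 16 * x / t\<^sup>2)"
    unfolding hil_def
  proof (rule set_integral_abs_le[OF hil_integrable])
    show "set_integrable lborel {0<..} (\<lambda>t. if t \<le> 2 * x then 16 / x else 16 * x / t\<^sup>2)"
      using assms by (intro set_integrable_piecewise) auto
    show "\<bar>(w (x - t) - w (x + t)) / t\<bar> \<le> (if t \<le> 2 * x then 16 / x else 16 * x / t\<^sup>2)"
      if "t \<in> {0<..}" for t
      using w_sym_diff_near[of t x] w_sym_diff_far[of t x] that assms
      by (auto simp: divide_simps power2_eq_square mult_ac split: if_splits)
  qed
  also have "\<dots> = 40" using assms by (subst set_integrable_piecewise(2)) auto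
  finally show ?thesis .
qed

lemma hil_bounded: "\<bar>hil x\<bar> \<le> 40"
proof -
  consider "x > 0" | "x = 0" | "- x > 0" by linarith
  then show ?thesis
  proof cases
    case 2
    then have "hil x = (LBINT t:{0<..}. 0)"
      unfolding hil_def by (simp add: w_even)
    then show ?thesis by simp
  qed (use hil_bounded_pos[of x] hil_bounded_pos[of "- x"] hil_odd[of x] in auto)
qed

text \<open>Choosing an antiderivative on the whole line avoids orientation conventions for negative
  arguments; the normalisation at 0 makes it odd.\<close>

definition Om :: "real \<Rightarrow> real" where
  "Om = (SOME F. F 0 = 0 \<and> (\<forall>x. (F has_real_derivative w x) (at x)))"

lemma Om_props: "Om 0 = 0 \<and> (\<forall>x. (Om has_real_derivative w x) (at x))"
proof -
  obtain F where F: "\<And>x. (F has_real_derivative w x) (at x)"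
    using einterval_antiderivative[of "-\<infinity>" \<infinity> w] w_isCont
    by (auto simp: has_real_derivative_iff_has_vector_derivative)
  have "\<exists>F. F 0 = 0 \<and> (\<forall>x. (F has_real_derivative w x) (at x))"
    by (rule exI[of _ "\<lambda>x. F x - F 0"]) (auto intro!: derivative_eq_intros F)
  then show ?thesis unfolding Om_def by (rule someI_ex)
qed

lemma Om_0 [simp]: "Om 0 = 0"
  using Om_props by simp

lemma Om_deriv: "(Om has_real_derivative w x) (at x)"
  using Om_props by simp

lemma Om_deriv_comp [derivative_intros]:
  "(g has_real_derivative g') (at x within A) \<Longrightarrow> ((\<lambda>x. Om (g x)) has_real_derivative w (g x) * g') (at x within A)"
  using DERIV_chain2[OF Om_deriv] .

lemma Om_odd: "Om (- x) = - Om x"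
proof -
  have "((\<lambda>x. Om x + Om (- x)) has_real_derivative 0) (at x)" for x
    by (auto intro!: derivative_eq_intros simp: w_even)
  then have "Om x + Om (- x) = Om 0 + Om (- 0)"
    using DERIV_isconst_all[of "\<lambda>x. Om x + Om (- x)" x 0] by blast
  then show ?thesis by simp
qed

lemma Om_lipschitz: "\<bar>Om x - Om y\<bar> \<le> \<bar>x - y\<bar>"
  using field_differentiable_bound[of UNIV Om w 1 x y] Om_deriv w_nonneg w_le_1 by auto

lemma Om_abs_le: "\<bar>Om x\<bar> \<le> \<bar>x\<bar>"
  using Om_lipschitz[of x 0] by simp

text \<open>Oddness turns the sum into a difference of values at distance 2 * |x|, so the bound does
  not grow with t.\<close>

lemma Om_sym_sum: "\<bar>Om (x - t) + Om (x + t)\<bar> \<le> 2 * \<bar>x\<bar>"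
  using Om_lipschitz[of "x + t" "t - x"] Om_odd[of "t - x"] by simp

lemma Om_isCont: "isCont Om x"
  using Om_deriv DERIV_isCont by blast

lemma continuous_on_Om: "continuous_on A f \<Longrightarrow> continuous_on A (\<lambda>t. Om (f t))"
  by (rule continuous_on_compose2[of UNIV])
    (auto simp: continuous_on_eq_continuous_at Om_isCont)

text \<open>The integrand of \<open>hil\<close> integrated in its argument from 0 to x; the boundary
  terms at 0 combine to 2 * Om t because \<open>Om\<close> is odd.\<close>

definition pot :: "real \<Rightarrow> real" where
  "pot x = (LBINT t:{0<..}. (Om (x - t) - Om (x + t) + 2 * Om t) / t)"

lemma pot_integrable: "set_integrable lborel {0<..} (\<lambda>t. (Om (x - t) - Om (x + t) + 2 * Om t) / t)"
proof (rule set_integrable_continuous_dominated)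
  let ?X = "\<bar>x\<bar> + 1"
  show "set_integrable lborel {0<..} (\<lambda>t. \<bar>x\<bar> * env ?X t)"
    by (intro set_integrable_mult_right env_integrable) auto
  show "continuous_on {0<..} (\<lambda>t. (Om (x - t) - Om (x + t) + 2 * Om t) / t)"
    by (intro continuous_intros continuous_on_Om) auto
  fix t :: real assume t: "t \<in> {0<..}"
  let ?F = "\<lambda>y. (Om (y - t) - Om (y + t) + 2 * Om t) / t"
  have der: "(?F has_real_derivative (w (y - t) - w (y + t)) / t) (at y)" for y
    using t by (auto intro!: derivative_eq_intros)
  \<comment> \<open>The integrand vanishes at 0, so it is at most |x| times a bound for its
    derivative in y.\<close>
  have "norm (?F x - ?F 0) \<le> env ?X t * norm (x - 0)"
  proof (rule field_differentiable_bound[of "closed_segment 0 x"])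
    show "norm ((w (y - t) - w (y + t)) / t) \<le> env ?X t" if "y \<in> closed_segment 0 x" for y
      using env_bound[of y ?X t] t that by (auto simp: closed_segment_eq_real_ivl split: if_splits)
  qed (use der has_field_derivative_at_within in blast)+
  then show "\<bar>?F x\<bar> \<le> \<bar>x\<bar> * env ?X t" by (simp add: Om_odd mult.commute)
qed auto

lemma pot_deriv: "(pot has_real_derivative hil x) (at x)"
  unfolding pot_def hil_def
proof (rule has_real_derivative_set_integral_dominated[of 1])
  show "set_integrable lborel {0<..} (env (\<bar>x\<bar> + 1))" by (rule env_integrable) auto
  show "\<bar>(w (y - t) - w (y + t)) / t\<bar> \<le> env (\<bar>x\<bar> + 1) t" if "\<bar>y - x\<bar> < 1" "t \<in> {0<..}" for y t
    using that by (intro env_bound) auto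
  show "((\<lambda>x. (Om (x - t) - Om (x + t) + 2 * Om t) / t) has_real_derivative (w (y - t) - w (y + t)) / t) (at y)"
    if "t \<in> {0<..}" for y t
    using that by (auto intro!: derivative_eq_intros)
qed (use pot_integrable in auto)

text \<open>The integrand is nonnegative, so t > x may be discarded. For t \<le> x, w (x + t) \<le>
  w x and 1 / t \<ge> 1 / x leave (w (x - t) - w x) / x, which has an explicit primitive.\<close>

lemma hil_lower:
  assumes "x > 0"
  shows "hil x \<ge> (Om x - x * w x) / x"
proof -
  have c: "continuous_on A (\<lambda>t. (w (x - t) - w x) / x)" for A
    using assms by (intro continuous_intros continuous_on_w) auto
  have i0: "set_integrable lborel {0<..x} (\<lambda>t. (w (x - t) - w x) / x)"
    by (rule set_integrable_subset[of _ "{0..x}"]) (auto intro: borel_integrable_atLeastAtMost' c)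
  have i1: "set_integrable lborel {0<..x} (\<lambda>t. (w (x - t) - w (x + t)) / t)"
    by (rule set_integrable_subset[OF hil_integrable]) auto
  have i2: "set_integrable lborel {x<..} (\<lambda>t. (w (x - t) - w (x + t)) / t)"
    by (rule set_integrable_subset[OF hil_integrable]) (use assms in auto)
  have "(Om x - x * w x) / x = (LBINT t=0..x. (w (x - t) - w x) / x)"
  proof -
    have "(LBINT t=0..x. (w (x - t) - w x) / x)
        = (- Om (x - x) - w x * x) / x - (- Om (x - 0) - w x * 0) / x"
      using assms
      by (subst zero_ereal_def, intro interval_integral_FTC_finite c)
        (auto intro!: derivative_eq_intros simp flip: has_real_derivative_iff_has_vector_derivative)
    then show ?thesis by (simp add: diff_divide_distrib mult.commute)
  qed
  also have "\<dots> = (LBINT t:{0<..x}. (w (x - t) - w x) / x)"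
    using assms by (subst zero_ereal_def, subst interval_integral_Ioc) auto
  also have "\<dots> \<le> (LBINT t:{0<..x}. (w (x - t) - w (x + t)) / t)"
  proof (rule set_integral_mono[OF i0 i1])
    fix t assume t: "t \<in> {0<..x}"
    have "w x \<le> w (x - t)" "w (x + t) \<le> w x" using t by (auto intro: w_antimono)
    then show "(w (x - t) - w x) / x \<le> (w (x - t) - w (x + t)) / t"
      using t by (intro frac_le) auto
  qed
  also have "\<dots> \<le> (LBINT t:{0<..x}. (w (x - t) - w (x + t)) / t) + (LBINT t:{x<..}. (w (x - t) - w (x + t)) / t)"
  proof -
    have "0 \<le> (LBINT t:{x<..}. (w (x - t) - w (x + t)) / t)"
      unfolding set_lebesgue_integral_def
      by (rule Bochner_Integration.integral_nonneg) (use w_sym_diff_nonneg[of x] assms in \<open>auto simp: indicator_def\<close>)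
    then show ?thesis by simp
  qed
  also have "\<dots> = hil x"
    unfolding hil_def split_Ioi[OF assms] by (rule set_integral_Un[symmetric, OF _ i1 i2]) auto
  finally show ?thesis .
qed

end

section \<open>Regularity of the Hilbert transform\<close>

lemma inverse_square_integrable: "d > 0 \<Longrightarrow> set_integrable lborel {d<..} (\<lambda>t. K * (1 / t\<^sup>2))" for K d :: real
  by (intro set_integrable_mult_right set_integral_inverse_square_Ioi)

lemma one_div_power_le:
  fixes t d :: real
  assumes "0 < d" "d < t" "2 \<le> n"
  shows "1 / t ^ n \<le> (1 / d ^ (n - 2)) * (1 / t\<^sup>2)"
proof -
  have "t ^ n = t ^ (n - 2) * t\<^sup>2" using assms(3) by (metis le_add_diff_inverse2 power_add)
  moreover have "d ^ (n - 2) * t\<^sup>2 \<le> t ^ (n - 2) * t\<^sup>2"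
    using assms by (intro mult_right_mono power_mono) auto
  ultimately have "1 / t ^ n \<le> 1 / (d ^ (n - 2) * t\<^sup>2)"
    using assms by (intro divide_left_mono) auto
  then show ?thesis by simp
qed

section \<open>The tail of the Hilbert transform and its derivatives\<close>

context profile
begin

text \<open>The integral of w y / (x - y)^m over |x - y| > d; the sign comes from y = x + t, where x
  - y = - t. Order 1 is the tail of \<open>hil\<close>, and higher orders arise by differentiating
  the kernel.\<close>

definition far :: "nat \<Rightarrow> real \<Rightarrow> real \<Rightarrow> real" where
  "far m d x = (LBINT t:{d<..}. (w (x - t) + (-1) ^ m * w (x + t)) / t ^ m)"

lemma w_pm_bound: "\<bar>w x + (-1) ^ m * w y\<bar> \<le> 2" "\<bar>w x - (-1) ^ m * w y\<bar> \<le> 2"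
  using w_nonneg[of x] w_nonneg[of y] w_le_1[of x] w_le_1[of y] by (cases "even m"; simp)+

lemma far_integrand_bound:
  assumes "0 < d" "2 \<le> m" "t \<in> {d<..}"
  shows "\<bar>(w (x - t) + (-1) ^ m * w (x + t)) / t ^ m\<bar> \<le> 2 / d ^ (m - 2) * (1 / t\<^sup>2)"
proof -
  have "\<bar>(w (x - t) + (-1) ^ m * w (x + t)) / t ^ m\<bar> \<le> 2 * (1 / t ^ m)"
    using w_pm_bound(1)[of "x - t" m "x + t"] assms by (simp add: abs_divide divide_right_mono)
  also have "\<dots> \<le> 2 * ((1 / d ^ (m - 2)) * (1 / t\<^sup>2))"
    by (intro mult_left_mono one_div_power_le) (use assms in auto)
  finally show ?thesis by simp
qed

lemma far_integrable:
  assumes "0 < d" "1 \<le> m"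
  shows "set_integrable lborel {d<..} (\<lambda>t. (w (x - t) + (-1) ^ m * w (x + t)) / t ^ m)"
proof (cases "m = 1")
  \<comment> \<open>The kernel 1 / t is not integrable at infinity; order 1 converges only through
    the cancellation used for \<open>hil\<close>.\<close>
  case True
  have "set_integrable lborel {d<..} (\<lambda>t. (w (x - t) - w (x + t)) / t)"
    by (rule set_integrable_subset[OF hil_integrable]) (use assms in auto)
  then show ?thesis by (simp add: True)
next
  case False
  then have "2 \<le> m" using assms by simp
  then show ?thesis
    by (intro set_integrable_continuous_dominated[OF inverse_square_integrable[OF assms(1)] _ _ far_integrand_bound])
      (use assms in \<open>auto intro!: continuous_intros continuous_on_w\<close>)
qed

lemma hil_split:
  assumes "0 < d"
  shows "hil x = near_hilbert d w x + far 1 d x"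
proof -
  have i1: "set_integrable lborel {0<..d} (\<lambda>t. (w (x - t) - w (x + t)) / t)"
    and i2: "set_integrable lborel {d<..} (\<lambda>t. (w (x - t) - w (x + t)) / t)"
    by (rule set_integrable_subset[OF hil_integrable]; use assms in auto)+
  show ?thesis
    unfolding hil_def near_hilbert_def far_def split_Ioi[OF assms]
    by (subst set_integral_Un[OF _ i1 i2]) auto
qed

text \<open>The sign is chosen so that the t-derivative is minus the numerator in
  \<open>far m\<close>, while the x-derivative is the numerator in
  \<open>far (Suc m)\<close>.\<close>

definition Om_pm :: "nat \<Rightarrow> real \<Rightarrow> real \<Rightarrow> real" where
  "Om_pm m x t = Om (x - t) - (-1) ^ m * Om (x + t)"

text \<open>For m = 1 the numerator stays bounded in t by oddness of \<open>Om\<close>. For m \<ge>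
  2 linear growth of \<open>Om\<close> is affordable. The constant is the sum of the two
  cases.\<close>

lemma Om_pm_bound:
  assumes "0 < d" "1 \<le> m" "t \<in> {d<..}"
  shows "\<bar>Om_pm m x t / t ^ Suc m\<bar> \<le> (2 * \<bar>x\<bar> + 2 * (\<bar>x\<bar> / d + 1) / d ^ (m - 2)) * (1 / t\<^sup>2)"
proof (cases "m = 1")
  case True
  have "\<bar>Om_pm m x t / t ^ Suc m\<bar> \<le> 2 * \<bar>x\<bar> * (1 / t\<^sup>2)"
    using Om_sym_sum[of x t] assms by (simp add: True Om_pm_def abs_divide divide_right_mono power2_eq_square)
  also have "\<dots> \<le> (2 * \<bar>x\<bar> + 2 * (\<bar>x\<bar> / d + 1) / d ^ (m - 2)) * (1 / t\<^sup>2)"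
    using assms by (intro mult_right_mono) auto
  finally show ?thesis .
next
  case False
  have t: "0 < t" using assms by auto
  have "\<bar>Om_pm m x t\<bar> \<le> \<bar>Om (x - t)\<bar> + \<bar>Om (x + t)\<bar>"
    unfolding Om_pm_def by (cases "even m") auto
  also have "\<dots> \<le> 2 * (\<bar>x\<bar> + t)" using Om_abs_le[of "x - t"] Om_abs_le[of "x + t"] t by (simp add: abs_if split: if_splits)
  also have "\<dots> = 2 * (\<bar>x\<bar> / t + 1) * t" using t by (simp add: field_simps)
  also have "\<dots> \<le> 2 * (\<bar>x\<bar> / d + 1) * t"
    using assms t by (intro mult_right_mono mult_left_mono add_right_mono divide_left_mono) auto
  finally have "\<bar>Om_pm m x t\<bar> / t ^ Suc m \<le> 2 * (\<bar>x\<bar> / d + 1) * t / t ^ Suc m"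
    using t by (intro divide_right_mono) auto
  then have "\<bar>Om_pm m x t / t ^ Suc m\<bar> \<le> 2 * (\<bar>x\<bar> / d + 1) * (1 / t ^ m)"
    using t by (simp add: abs_divide)
  also have "\<dots> \<le> 2 * (\<bar>x\<bar> / d + 1) * ((1 / d ^ (m - 2)) * (1 / t\<^sup>2))"
    using assms False by (intro mult_left_mono one_div_power_le) auto
  also have "\<dots> = 2 * (\<bar>x\<bar> / d + 1) / d ^ (m - 2) * (1 / t\<^sup>2)" by simp
  also have "\<dots> \<le> (2 * \<bar>x\<bar> + 2 * (\<bar>x\<bar> / d + 1) / d ^ (m - 2)) * (1 / t\<^sup>2)"
    by (intro mult_right_mono) auto
  finally show ?thesis .
qed

lemma continuous_on_Om_pm: "continuous_on A (\<lambda>t. Om_pm m x t)"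
  unfolding Om_pm_def by (intro continuous_intros continuous_on_Om)

lemma Om_pm_integrable:
  assumes "0 < d" "1 \<le> m"
  shows "set_integrable lborel {d<..} (\<lambda>t. Om_pm m x t / t ^ Suc m)"
  by (rule set_integrable_continuous_dominated[OF inverse_square_integrable[OF assms(1)] _ _ Om_pm_bound[OF assms]])
    (use assms in \<open>auto intro!: continuous_intros continuous_on_Om_pm\<close>)

text \<open>In this form x enters through \<open>Om\<close>, which is differentiable, instead of w,
  which is only known to be Lipschitz. The boundary term at infinity is O(1 / t).\<close>

lemma far_by_parts:
  assumes d: "0 < d" and m: "1 \<le> m"
  shows "far m d x = Om_pm m x d / d ^ m - m * (LBINT t:{d<..}. Om_pm m x t / t ^ Suc m)"
proof -
  let ?F = "\<lambda>t. Om_pm m x t / t ^ m"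
  let ?f = "\<lambda>t. - ((w (x - t) + (-1) ^ m * w (x + t)) / t ^ m) - m * (Om_pm m x t / t ^ Suc m)"
  have i1: "set_integrable lborel {d<..} (\<lambda>t. - ((w (x - t) + (-1) ^ m * w (x + t)) / t ^ m))"
    using set_integrable_mult_right[OF far_integrable[OF d m, of x], of "-1"] by (simp only: mult_minus1)
  have i2: "set_integrable lborel {d<..} (\<lambda>t. m * (Om_pm m x t / t ^ Suc m))"
    using set_integrable_mult_right[OF Om_pm_integrable[OF d m]] by simp
  have "(LBINT t=ereal d..\<infinity>. ?f t) = 0 - ?F d"
  proof (rule interval_integral_FTC_integrable)
    fix t assume "ereal d < ereal t"
    then have t: "t > 0" using d by simp
    have "(?F has_real_derivative ?f t) (at t)"
    proof -
      obtain k where k: "m = Suc k" using m by (cases m) auto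
      have "(Om_pm m x has_real_derivative - w (x - t) - (-1) ^ m * w (x + t)) (at t)"
        unfolding Om_pm_def by (auto intro!: derivative_eq_intros)
      from DERIV_divide[OF this DERIV_pow[of m t]] show ?thesis
        by (rule DERIV_cong) (use t in \<open>auto simp: k field_simps\<close>)
    qed
    then show "(?F has_vector_derivative ?f t) (at t)"
      by (simp add: has_real_derivative_iff_has_vector_derivative)
    have "continuous_on {0<..} ?f"
      by (intro continuous_intros continuous_on_w continuous_on_Om_pm) auto
    then show "isCont ?f t" using t by (simp add: continuous_on_eq_continuous_at)
  next
    show "set_integrable lborel (einterval (ereal d) \<infinity>) ?f"
      using set_integral_diff(1)[OF i1 i2] by simp
    have "isCont ?F d"
      using d continuous_on_Om_pm[of UNIV m x] by (intro continuous_intros) (auto simp: continuous_on_eq_continuous_at)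
    then have "(?F \<longlongrightarrow> ?F d) (at_right d)"
      by (simp add: continuous_at filterlim_at_split)
    then show "((?F \<circ> real_of_ereal) \<longlongrightarrow> ?F d) (at_right (ereal d))"
      by (simp add: ereal_tendsto_simps)
    have "(?F \<longlongrightarrow> 0) at_top"
    proof (rule Lim_null_comparison)
      let ?K = "(2 * \<bar>x\<bar> + 2 * (\<bar>x\<bar> / d + 1) / d ^ (m - 2))"
      show "((\<lambda>t. ?K * (1 / t)) \<longlongrightarrow> 0) at_top"
        by (intro tendsto_mult_right_zero tendsto_divide_0[OF tendsto_const] filterlim_at_top_imp_at_infinity filterlim_ident)
      show "\<forall>\<^sub>F t in at_top. norm (?F t) \<le> ?K * (1 / t)"
      proof (rule eventually_mono[OF eventually_gt_at_top[of d]])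
        fix t assume t: "d < t"
        have "\<bar>Om_pm m x t / t ^ Suc m\<bar> * t \<le> ?K * (1 / t\<^sup>2) * t"
          by (intro mult_right_mono Om_pm_bound) (use d m t in auto)
        then show "norm (?F t) \<le> ?K * (1 / t)"
          using t d by (simp add: abs_divide power2_eq_square)
      qed
    qed
    then show "((?F \<circ> real_of_ereal) \<longlongrightarrow> 0) (at_left \<infinity>)"
      by (simp add: ereal_tendsto_simps)
  qed simp
  then have "(LBINT t:{d<..}. ?f t) = - ?F d"
    unfolding interval_integral_to_infinity_eq by simp
  moreover have "(LBINT t:{d<..}. ?f t) = - far m d x - m * (LBINT t:{d<..}. Om_pm m x t / t ^ Suc m)"
    unfolding set_integral_diff(2)[OF i1 i2] far_def set_integral_uminus[OF far_integrable[OF d m]] set_integral_mult_right ..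
  ultimately show ?thesis by simp
qed

text \<open>Besides a tail of the next order only the values of w at x - d and x + d appear, so the
  derivative exists without any differentiability of w.\<close>

lemma far_deriv:
  assumes d: "0 < d" and m: "1 \<le> m"
  shows "(far m d has_real_derivative (w (x - d) - (-1) ^ m * w (x + d)) / d ^ m - m * far (Suc m) d x) (at x)"
proof -
  have "((\<lambda>x. LBINT t:{d<..}. Om_pm m x t / t ^ Suc m) has_real_derivative
      (LBINT t:{d<..}. (w (x - t) - (-1) ^ m * w (x + t)) / t ^ Suc m)) (at x)"
  proof (rule has_real_derivative_set_integral_dominated[OF zero_less_one])
    show "set_integrable lborel {d<..} (\<lambda>t. 2 / d ^ (Suc m - 2) * (1 / t\<^sup>2))"
      by (rule inverse_square_integrable[OF d])
    show "((\<lambda>x. Om_pm m x t / t ^ Suc m) has_real_derivative (w (y - t) - (-1) ^ m * w (y + t)) / t ^ Suc m) (at y)"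
      if "t \<in> {d<..}" for y t
      unfolding Om_pm_def using that d by (auto intro!: derivative_eq_intros)
    show "\<bar>(w (y - t) - (-1) ^ m * w (y + t)) / t ^ Suc m\<bar> \<le> 2 / d ^ (Suc m - 2) * (1 / t\<^sup>2)"
      if "t \<in> {d<..}" for y t
      using far_integrand_bound[OF d, of "Suc m" t y] that m by simp
  qed (rule Om_pm_integrable[OF d m])
  moreover have "(LBINT t:{d<..}. (w (x - t) - (-1) ^ m * w (x + t)) / t ^ Suc m) = far (Suc m) d x"
    by (simp add: far_def)
  moreover have "((\<lambda>x. Om_pm m x d / d ^ m) has_real_derivative (w (x - d) - (-1) ^ m * w (x + d)) / d ^ m) (at x)"
    unfolding Om_pm_def using d by (auto intro!: derivative_eq_intros)
  ultimately have "((\<lambda>x. Om_pm m x d / d ^ m - m * (LBINT t:{d<..}. Om_pm m x t / t ^ Suc m))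
      has_real_derivative (w (x - d) - (-1) ^ m * w (x + d)) / d ^ m - m * far (Suc m) d x) (at x)"
    by (intro DERIV_diff DERIV_cmult) auto
  moreover have "far m d = (\<lambda>x. Om_pm m x d / d ^ m - m * (LBINT t:{d<..}. Om_pm m x t / t ^ Suc m))"
    using far_by_parts[OF d m] by blast
  ultimately show ?thesis by simp
qed

lemma far_bounded:
  assumes d: "0 < d" and m: "1 \<le> m"
  obtains B where "\<And>x. \<bar>far m d x\<bar> \<le> B"
proof (cases "m = 1")
  \<comment> \<open>For order 1 the majorant from cancellation depends on x; the uniform bound comes
    from writing the tail as \<open>hil\<close> minus its near part.\<close>
  case True
  have "hoelder_bdd UNIV (near_hilbert d w)"
    by (rule hoelder_bdd_near_hilbert[OF _ d hoelder_bdd_w]) auto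
  then obtain B where B: "\<And>x. \<bar>near_hilbert d w x\<bar> \<le> B"
    unfolding hoelder_bdd_def by auto
  have "\<bar>far m d x\<bar> \<le> 40 + B" for x
    using hil_bounded[of x] hil_split[OF d, of x] B[of x] unfolding True by linarith
  then show ?thesis by (rule that)
next
  case False
  then have m2: "2 \<le> m" using m by simp
  show ?thesis
    by (rule that) (unfold far_def, rule set_integral_abs_le[OF far_integrable[OF d m]
          inverse_square_integrable[OF d] far_integrand_bound[OF d m2]])
qed

lemma hoelder_bdd_far:
  assumes d: "0 < d" and m: "1 \<le> m"
  shows "hoelder_bdd UNIV (far m d)"
proof -
  obtain B where B: "\<And>x. \<bar>far m d x\<bar> \<le> B" using far_bounded[OF d m] by blast
  obtain B' where B': "\<And>x. \<bar>far (Suc m) d x\<bar> \<le> B'" using far_bounded[OF d, of "Suc m"] by auto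
  show ?thesis
  proof (rule hoelder_bdd_deriv_bounded[OF convex_UNIV B far_deriv[OF d m]])
    fix x
    have "\<bar>(w (x - d) - (-1) ^ m * w (x + d)) / d ^ m\<bar> \<le> 2 / d ^ m"
      using w_pm_bound(2)[of "x - d" m "x + d"] d by (simp add: abs_divide divide_right_mono)
    moreover have "\<bar>m * far (Suc m) d x\<bar> \<le> m * B'"
      using B'[of x] by (simp add: abs_mult mult_left_mono)
    ultimately show "\<bar>(w (x - d) - (-1) ^ m * w (x + d)) / d ^ m - m * far (Suc m) d x\<bar> \<le> 2 / d ^ m + m * B'"
      by linarith
  qed
qed

section \<open>Passage from the regularity of w near S to that of hil on S\<close>

context
  fixes S S' :: "real set" and d :: real
  assumes S: "\<And>x t. x \<in> S \<Longrightarrow> \<bar>t\<bar> \<le> d \<Longrightarrow> x + t \<in> S'" and d: "d > 0" and S_open: "open S"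
begin

text \<open>The induction runs over all m together because each derivative raises m. The boundary
  terms are translates of w by d and - d, hence the need for S'.\<close>

lemma hoelder_C_far:
  assumes w: "hoelder_C n S' w"
  shows "j \<le> n \<Longrightarrow> 1 \<le> m \<Longrightarrow> hoelder_C j S (far m d)"
proof (induction j arbitrary: m)
  case 0
  then show ?case using hoelder_bdd_subset[OF hoelder_bdd_far[OF d]] by simp
next
  case (Suc j)
  have w_j: "hoelder_C j S' w" by (rule hoelder_C_mono[OF _ w]) (use Suc in simp)
  have s: "hoelder_C j S (\<lambda>x. w (x + - d))" "hoelder_C j S (\<lambda>x. w (x + d))"
    by (rule hoelder_C_shift[OF _ w_j]; use S[of _ d] S[of _ "- d"] d in auto)+
  have "hoelder_C j S (\<lambda>x. 1 / d ^ m * (w (x + - d) - (-1) ^ m * w (x + d)) + - real m * far (Suc m) d x)"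
    using Suc by (intro hoelder_C_add hoelder_C_cmult hoelder_C_diff s) auto
  moreover have "(\<lambda>x. 1 / d ^ m * (w (x + - d) - (-1) ^ m * w (x + d)) + - real m * far (Suc m) d x)
      = (\<lambda>x. (w (x - d) - (-1) ^ m * w (x + d)) / d ^ m - m * far (Suc m) d x)"
    by auto
  ultimately have "hoelder_C j S (\<lambda>x. (w (x - d) - (-1) ^ m * w (x + d)) / d ^ m - m * far (Suc m) d x)"
    by simp
  then show ?case
    by (intro hoelder_C_SucI[OF hoelder_bdd_subset[OF hoelder_bdd_far[OF d]] far_deriv[OF d]]) (use Suc in auto)
qed

lemma hoelder_C_hil:
  assumes "hoelder_C n S' w"
  shows "hoelder_C n S hil"
proof -
  have "hoelder_C n S (\<lambda>x. near_hilbert d w x + far 1 d x)"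
    by (rule hoelder_C_add[OF hoelder_C_near_hilbert[OF S d S_open assms] hoelder_C_far[OF assms]]) auto
  then show ?thesis using hil_split[OF d] by (rule_tac hoelder_C_cong[OF S_open]) auto
qed

end

end

section \<open>The potential as a primitive of the Hilbert transform\<close>

text \<open>Reduces half-line Lebesgue integrals to gauge integrals over [0, B], where the
  fundamental theorem of calculus applies with singular points.\<close>

lemma tendsto_integral_Icc_at_top:
  fixes f :: "real \<Rightarrow> real"
  assumes f: "set_integrable lborel {0<..} f"
  shows "((\<lambda>B. integral {0..B} f) \<longlongrightarrow> (LBINT t:{0<..}. f t)) at_top"
proof -
  let ?g = "\<lambda>t. indicator {0<..} t * f t"
  have ind: "indicator {0..B} t *\<^sub>R ?g t = indicator {0<..B} t *\<^sub>R f t" for B t :: real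
    by (auto simp: indicator_def)
  have ind': "indicator {0..} t *\<^sub>R ?g t = indicator {0<..} t *\<^sub>R f t" for t :: real
    by (auto simp: indicator_def)
  have "set_integrable lborel {0..} ?g"
    using f unfolding set_integrable_def ind' .
  then have "((\<lambda>B. LBINT t:{0..B}. ?g t) \<longlongrightarrow> (LBINT t:{0..}. ?g t)) at_top"
    by (intro tendsto_set_lebesgue_integral_at_top) auto
  then have lim: "((\<lambda>B. LBINT t:{0<..B}. f t) \<longlongrightarrow> (LBINT t:{0<..}. f t)) at_top"
    unfolding set_lebesgue_integral_def ind ind' .
  have "(LBINT t:{0<..B}. f t) = integral {0..B} f" if "B > 0" for B
  proof -
    have "set_integrable lborel {0<..B} f" by (rule set_integrable_subset[OF f]) auto
    then have "(LBINT t:{0<..B}. f t) = integral {0<..B} f" by (rule set_borel_integral_eq_integral)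
    also have "\<dots> = integral {0..B} f"
    proof (rule integral_subset_negligible)
      have "{0..B} - {0<..B} = {0}" using that by auto
      then show "negligible ({0..B} - {0<..B})" by simp
    qed auto
    finally show ?thesis .
  qed
  then have "\<forall>\<^sub>F B in at_top. (LBINT t:{0<..B}. f t) = integral {0..B} f"
    by (rule_tac eventually_mono[OF eventually_gt_at_top[of 0]]) blast
  from Lim_transform_eventually[OF lim this] show ?thesis .
qed

lemma ln_abs_deriv:
  fixes y c :: real
  assumes "y \<noteq> c"
  shows "((\<lambda>y. ln \<bar>y - c\<bar>) has_real_derivative 1 / (y - c)) (at y)"
proof -
  \<comment> \<open>Avoids a case split on the sign; u = 0 is covered because ln 0 = 0.\<close>
  have eq: "ln \<bar>u\<bar> = ln (u\<^sup>2) / 2" for u :: real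
  proof (cases "u = 0")
    case False
    then have "ln (\<bar>u\<bar>\<^sup>2) = 2 * ln \<bar>u\<bar>" by (subst ln_realpow) auto
    then show ?thesis by simp
  qed simp
  have "0 < (y - c)\<^sup>2" using assms by simp
  then show ?thesis
    unfolding eq using assms by (auto intro!: derivative_eq_intros simp: power2_eq_square field_simps)
qed

text \<open>This tames the logarithmic singularities of \<open>parts\<close> at y = x and y =
  0.\<close>

lemma isCont_mult_ln_abs: "isCont (\<lambda>u::real. u * ln \<bar>u\<bar>) u"
proof (cases "u = 0")
  case False
  then have "isCont (\<lambda>u. ln \<bar>u\<bar>) u"
    by (intro continuous_intros) auto
  then show ?thesis by (intro continuous_mult continuous_ident)
next
  case True
  have bound: "\<bar>u * ln \<bar>u\<bar>\<bar> \<le> 2 * sqrt \<bar>u\<bar>" if "\<bar>u\<bar> < 1" for u :: real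
  proof (cases "u = 0")
    case False
    \<comment> \<open>Apply ln s \<le> s - 1 to s = 1 / sqrt |u|; the square root leaves a power of
      u to spare.\<close>
    have "- ln \<bar>u\<bar> = 2 * ln (1 / sqrt \<bar>u\<bar>)" using False by (simp add: ln_div ln_sqrt)
    also have "\<dots> \<le> 2 * (1 / sqrt \<bar>u\<bar>)"
    proof -
      have "ln (1 / sqrt \<bar>u\<bar>) \<le> 1 / sqrt \<bar>u\<bar> - 1" by (rule ln_le_minus_one) (use False in auto)
      then show ?thesis by simp
    qed
    finally have l: "- ln \<bar>u\<bar> \<le> 2 / sqrt \<bar>u\<bar>" by simp
    have "ln \<bar>u\<bar> \<le> 0" using that False by simp
    then have "\<bar>u * ln \<bar>u\<bar>\<bar> = \<bar>u\<bar> * (- ln \<bar>u\<bar>)" by (simp add: abs_mult)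
    also have "\<dots> \<le> \<bar>u\<bar> * (2 / sqrt \<bar>u\<bar>)" using l by (intro mult_left_mono) auto
    also have "\<dots> = 2 * sqrt \<bar>u\<bar>" using False by (simp add: field_simps real_div_sqrt)
    finally show ?thesis .
  qed simp
  have l0: "((\<lambda>u. 2 * sqrt \<bar>u\<bar>) \<longlongrightarrow> 0) (at (0::real))"
    by (auto intro!: tendsto_eq_intros)
  have "((\<lambda>u::real. u * ln \<bar>u\<bar>) \<longlongrightarrow> 0) (at 0)"
  proof (rule Lim_null_comparison[OF _ l0])
    show "\<forall>\<^sub>F u in at 0. norm (u * ln \<bar>u\<bar>) \<le> 2 * sqrt \<bar>u\<bar>"
      unfolding eventually_at by (rule exI[of _ 1]) (use bound in \<open>auto simp: dist_real_def\<close>)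
  qed
  then show ?thesis using True by (simp add: isCont_def)
qed

lemma continuous_on_mult_ln_abs: "continuous_on A f \<Longrightarrow> continuous_on A (\<lambda>y. f y * ln \<bar>f y :: real\<bar>)"
  using continuous_on_compose2[of UNIV "\<lambda>u. u * ln \<bar>u\<bar>" A f] isCont_mult_ln_abs
  by (auto simp: continuous_on_eq_continuous_at)

lemma abs_ln_one_minus_le:
  fixes u :: real
  assumes "0 \<le> u" "u \<le> 1 / 2"
  shows "\<bar>ln (1 - u)\<bar> \<le> 2 * u"
proof -
  have "- ln (1 - u) = ln (1 / (1 - u))" using assms by (simp add: ln_div)
  also have "\<dots> \<le> 1 / (1 - u) - 1" by (rule ln_le_minus_one) (use assms in auto)
  also have "\<dots> = u / (1 - u)" using assms by (simp add: field_simps)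
  also have "\<dots> \<le> u / (1 / 2)" using assms by (intro divide_left_mono) auto
  finally have "- ln (1 - u) \<le> 2 * u" by simp
  moreover have "ln (1 - u) \<le> 0" using assms by simp
  ultimately show ?thesis by simp
qed

lemma log_kernel_bound:
  fixes x y :: real
  assumes "0 < x" "2 * x \<le> y"
  shows "\<bar>ln \<bar>(x\<^sup>2 - y\<^sup>2) / y\<^sup>2\<bar>\<bar> \<le> 2 * x\<^sup>2 / y\<^sup>2"
proof -
  have y: "y > 0" using assms by simp
  have "(2 * x)\<^sup>2 \<le> y\<^sup>2" using assms by (intro power_mono) auto
  then have le: "4 * x\<^sup>2 \<le> y\<^sup>2" by (simp add: power_mult_distrib)
  have le2: "2 * x\<^sup>2 \<le> y\<^sup>2" using le zero_le_power2[of x] by linarith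
  have u: "0 \<le> x\<^sup>2 / y\<^sup>2" "x\<^sup>2 / y\<^sup>2 \<le> 1 / 2" using y le2 by (auto simp: field_simps)
  have "\<bar>(x\<^sup>2 - y\<^sup>2) / y\<^sup>2\<bar> = 1 - x\<^sup>2 / y\<^sup>2"
  proof -
    have "(x\<^sup>2 - y\<^sup>2) / y\<^sup>2 = - (1 - x\<^sup>2 / y\<^sup>2)" using y by (simp add: diff_divide_distrib)
    then show ?thesis using u by (simp only: abs_minus_cancel)
  qed
  then show ?thesis using abs_ln_one_minus_le[OF u] by simp
qed

section \<open>Integration by parts against the logarithmic kernel\<close>

context profile
begin

text \<open>Filling in the value at y = c makes the quotient continuous on the line, so that its
  integrals need no care at the singular point.\<close>

definition Om_slope :: "real \<Rightarrow> real \<Rightarrow> real" where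
  "Om_slope c y = (if y = c then w c else (Om y - Om c) / (y - c))"

lemma continuous_on_Om_slope: "continuous_on A f \<Longrightarrow> continuous_on A (\<lambda>t. Om_slope c (f t))"
proof (rule continuous_on_compose2[of UNIV "Om_slope c"])
  have "isCont (Om_slope c) y" for y
  proof (cases "y = c")
    case True
    have "((\<lambda>y. (Om y - Om c) / (y - c)) \<longlongrightarrow> w c) (at c)"
      using Om_deriv[of c] by (simp add: has_field_derivative_iff)
    then have "(Om_slope c \<longlongrightarrow> w c) (at c)"
      by (rule Lim_transform_eventually) (auto simp: Om_slope_def eventually_at_filter)
    then show ?thesis by (simp add: isCont_def True Om_slope_def)
  next
    case False
    have "continuous_on (- {c}) (\<lambda>y. (Om y - Om c) / (y - c))"
      by (intro continuous_intros continuous_on_Om) auto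
    then have "continuous_on (- {c}) (Om_slope c)"
      by (rule continuous_on_eq) (auto simp: Om_slope_def)
    then show ?thesis using False by (simp add: continuous_on_eq_continuous_at open_Compl)
  qed
  then show "continuous_on UNIV (Om_slope c)" by (simp add: continuous_on_eq_continuous_at)
qed auto

definition log_ker :: "real \<Rightarrow> real \<Rightarrow> real" where
  "log_ker x y = ln \<bar>(x\<^sup>2 - y\<^sup>2) / y\<^sup>2\<bar> * w y"

text \<open>The logarithmic kernel splits into three logarithms, each paired with a primitive of w.
  The constants - Om x and Om x are chosen so that the singularity at y = x cancels and
  \<open>parts x 0 = 0\<close>.\<close>

definition parts :: "real \<Rightarrow> real \<Rightarrow> real" where
  "parts x y = ln \<bar>y - x\<bar> * (Om y - Om x) + ln (x + y) * (Om y + Om x) - 2 * ln \<bar>y\<bar> * Om y"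

lemma parts_deriv:
  assumes x: "x > 0" and y: "y > 0" "y \<noteq> x"
  shows "(parts x has_real_derivative
      log_ker x y + (Om_slope x y + Om_slope x (- y) - 2 * Om_slope 0 y)) (at y)"
proof -
  have l: "ln \<bar>(x\<^sup>2 - y\<^sup>2) / y\<^sup>2\<bar> = ln \<bar>y - x\<bar> + ln (x + y) - 2 * ln \<bar>y\<bar>"
  proof -
    have "\<bar>(x\<^sup>2 - y\<^sup>2) / y\<^sup>2\<bar> = \<bar>y - x\<bar> * (x + y) / y\<^sup>2"
    proof -
      have "x\<^sup>2 - y\<^sup>2 = - (y - x) * (x + y)" by (simp add: power2_eq_square algebra_simps)
      then show ?thesis using x y by (simp add: abs_mult abs_divide)
    qed
    then show ?thesis using x y by (simp add: ln_div ln_mult ln_realpow)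
  qed
  have s: "Om_slope x y = (Om y - Om x) / (y - x)" "Om_slope x (- y) = (Om y + Om x) / (x + y)"
    "Om_slope 0 y = Om y / y"
    using x y by (auto simp: Om_slope_def Om_odd field_simps)
  have d1: "((\<lambda>y. ln \<bar>y - x\<bar>) has_real_derivative 1 / (y - x)) (at y)"
    by (rule ln_abs_deriv[OF y(2)])
  have d2: "((\<lambda>y. ln \<bar>y\<bar>) has_real_derivative 1 / y) (at y)"
    using ln_abs_deriv[of y 0] y by simp
  have d3: "((\<lambda>y. ln (x + y)) has_real_derivative 1 / (x + y)) (at y)"
    using x y by (auto intro!: derivative_eq_intros)
  have d4: "((\<lambda>y. Om y - Om x) has_real_derivative w y) (at y)"
    and d5: "((\<lambda>y. Om y + Om x) has_real_derivative w y) (at y)"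
    by (auto intro!: derivative_eq_intros)
  show ?thesis
    unfolding parts_def log_ker_def l s
    by (rule DERIV_cong[OF DERIV_diff[OF DERIV_add[OF DERIV_mult[OF d1 d4] DERIV_mult[OF d3 d5]]
          DERIV_mult[OF DERIV_cmult[OF d2] Om_deriv]]]) (simp add: algebra_simps diff_divide_distrib add_divide_distrib)
qed

lemma continuous_on_parts:
  assumes x: "x > 0"
  shows "continuous_on {0..B} (parts x)"
proof -
  \<comment> \<open>Each singular logarithm is rewritten as u * ln |u| times a continuous slope,
    which exhibits continuity through y = x and y = 0.\<close>
  have eq: "((y - x) * ln \<bar>y - x\<bar>) * Om_slope x y + ln (x + y) * (Om y + Om x) - 2 * (y * ln \<bar>y\<bar>) * Om_slope 0 y
      = parts x y" for y
    by (auto simp: parts_def Om_slope_def)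
  have "continuous_on {0..B}
      (\<lambda>y. ((y - x) * ln \<bar>y - x\<bar>) * Om_slope x y + ln (x + y) * (Om y + Om x) - 2 * (y * ln \<bar>y\<bar>) * Om_slope 0 y)"
    using x by (intro continuous_intros continuous_on_mult_ln_abs continuous_on_Om_slope continuous_on_Om) auto
  then show ?thesis unfolding eq .
qed

lemma slope_integrable: "(\<lambda>y. Om_slope x y + Om_slope x (- y) - 2 * Om_slope 0 y) integrable_on {a..b}"
  by (intro integrable_continuous_real continuous_intros continuous_on_Om_slope)

lemma log_ker_has_integral:
  assumes x: "x > 0" and B: "B \<ge> 0"
  shows "(log_ker x has_integral parts x B - integral {0..B} (\<lambda>y. Om_slope x y + Om_slope x (- y) - 2 * Om_slope 0 y)) {0..B}"
proof -
  let ?I = "\<lambda>y. Om_slope x y + Om_slope x (- y) - 2 * Om_slope 0 y"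
  \<comment> \<open>Continuity of \<open>parts x\<close> allows y = x as an exceptional point of the
    fundamental theorem.\<close>
  have "((\<lambda>y. log_ker x y + ?I y) has_integral parts x B - parts x 0) {0..B}"
    by (rule fundamental_theorem_of_calculus_interior_strong[of "{x}"])
      (use x B parts_deriv continuous_on_parts in \<open>auto simp flip: has_real_derivative_iff_has_vector_derivative\<close>)
  then have "((\<lambda>y. log_ker x y + ?I y) has_integral parts x B) {0..B}"
    using x by (simp add: parts_def)
  from has_integral_diff[OF this integrable_integral[OF slope_integrable[of x 0 B]]]
  show ?thesis by (simp only: add_diff_cancel_right')
qed

lemma log_ker_measurable: "log_ker x \<in> borel_measurable borel"
proof -
  have "w \<in> borel_measurable borel" by (rule borel_measurable_continuous_onI[OF w_cont])
  then show ?thesis unfolding log_ker_def by measurable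
qed

text \<open>Gauge integrability on [0, 2 * x] is already known. It becomes absolute because the
  kernel changes sign only once on the half-line, and beyond 2 * x the kernel is O(1 / y^2).\<close>

lemma log_ker_integrable:
  assumes x: "x > 0"
  shows "set_integrable lborel {0<..} (log_ker x)"
proof -
  \<comment> \<open>The sign change: (x^2 - y^2) / y^2 = 1 exactly for y = x / sqrt 2, when y >
    0.\<close>
  define c where "c = x / sqrt 2"
  have c: "c > 0" "c < 2 * x" "c\<^sup>2 = x\<^sup>2 / 2"
  proof -
    show "c > 0" using x by (simp add: c_def)
    have "1 \<le> sqrt 2" by simp
    then have "x / sqrt 2 \<le> x / 1" using x by (intro divide_left_mono) auto
    then show "c < 2 * x" using x by (simp add: c_def)
    show "c\<^sup>2 = x\<^sup>2 / 2" by (simp add: c_def power_divide)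
  qed
  have int: "log_ker x integrable_on {0..2 * x}"
    using log_ker_has_integral[OF x, of "2 * x"] x by (auto simp: integrable_on_def)
  have pos: "0 \<le> log_ker x y" if "y \<in> {0..c}" for y
  proof (cases "y = 0")
    case False
    have "y\<^sup>2 \<le> c\<^sup>2" using that by (intro power_mono) auto
    then have "1 \<le> (x\<^sup>2 - y\<^sup>2) / y\<^sup>2" using False c by (simp add: field_simps)
    then have "0 \<le> ln \<bar>(x\<^sup>2 - y\<^sup>2) / y\<^sup>2\<bar>" by (intro ln_ge_zero) linarith
    then show ?thesis using w_nonneg by (simp add: log_ker_def)
  qed (simp add: log_ker_def)
  have neg: "log_ker x y \<le> 0" if "y \<in> {c..}" for y
  proof -
    have y: "y > 0" using that c by auto
    have "c\<^sup>2 \<le> y\<^sup>2" using that c by (intro power_mono) auto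
    then have "\<bar>(x\<^sup>2 - y\<^sup>2) / y\<^sup>2\<bar> \<le> 1" using c y by (simp add: abs_divide abs_le_iff)
    then have "ln \<bar>(x\<^sup>2 - y\<^sup>2) / y\<^sup>2\<bar> \<le> 0"
      using ln_le_zero_iff[of "\<bar>(x\<^sup>2 - y\<^sup>2) / y\<^sup>2\<bar>"] by (cases "\<bar>(x\<^sup>2 - y\<^sup>2) / y\<^sup>2\<bar> = 0") (auto simp del: abs_divide)
    then show ?thesis using w_nonneg by (simp add: log_ker_def mult_nonpos_nonneg)
  qed
  have conv: "set_integrable lborel S f" if "f absolutely_integrable_on S" "S \<in> sets borel" "f \<in> borel_measurable borel"
    for f :: "real \<Rightarrow> real" and S
  proof -
    have "(\<lambda>t. indicator S t *\<^sub>R f t) \<in> borel_measurable lborel"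
      using that(2,3) by simp
    from integrable_completion[OF this] show ?thesis using that(1) unfolding set_integrable_def by simp
  qed
  have i1: "set_integrable lborel {0..c} (log_ker x)"
  proof (rule conv)
    show "log_ker x absolutely_integrable_on {0..c}"
      by (rule nonnegative_absolutely_integrable_1[OF integrable_subinterval_real[OF int]]) (use c pos in auto)
  qed (use log_ker_measurable in auto)
  have i2: "set_integrable lborel {c..2 * x} (\<lambda>y. - log_ker x y)"
  proof (rule conv)
    have "(\<lambda>y. - log_ker x y) integrable_on {c..2 * x}"
      using integrable_subinterval_real[OF int, of c "2 * x"] c by (intro integrable_neg) auto
    then show "(\<lambda>y. - log_ker x y) absolutely_integrable_on {c..2 * x}"
      by (rule nonnegative_absolutely_integrable_1) (use neg in auto)
  qed (use log_ker_measurable in auto)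
  have i2': "set_integrable lborel {c..2 * x} (log_ker x)"
    using set_integrable_mult_right[OF i2, of "-1"] by simp
  have i3: "set_integrable lborel {2 * x<..} (log_ker x)"
  proof (rule set_integrable_bound[OF inverse_square_integrable[of "2 * x" "2 * x\<^sup>2"]])
    show "set_borel_measurable lborel {2 * x<..} (log_ker x)"
      using log_ker_measurable by (simp add: set_borel_measurable_def)
    have "\<bar>log_ker x y\<bar> \<le> 2 * x\<^sup>2 / y\<^sup>2" if "2 * x < y" for y
    proof -
      have "\<bar>log_ker x y\<bar> \<le> (2 * x\<^sup>2 / y\<^sup>2) * 1"
        unfolding log_ker_def abs_mult
        by (intro mult_mono log_kernel_bound) (use x that w_nonneg w_le_1 in auto)
      then show ?thesis by simp
    qed
    then show "AE y in lborel. y \<in> {2 * x<..} \<longrightarrow> norm (log_ker x y) \<le> norm (2 * x\<^sup>2 * (1 / y\<^sup>2))"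
      by auto
  qed (use x in auto)
  have "set_integrable lborel ({0..c} \<union> {c..2 * x} \<union> {2 * x<..}) (log_ker x)"
    by (intro set_integrable_Un i1 i2' i3) auto
  then show ?thesis by (rule set_integrable_subset) (use c x in auto)
qed

text \<open>Brings \<open>pot\<close> into the slope form that integration by parts gives for
  \<open>log_ker\<close>; only the arguments of \<open>Om_slope x\<close> are translated by
  x.\<close>

lemma pot_integral:
  assumes B: "B > 0"
  shows "integral {0..B} (\<lambda>t. (Om (x - t) - Om (x + t) + 2 * Om t) / t)
    = - integral {0..B} (\<lambda>t. Om_slope x (x + t) + Om_slope x (x - t) - 2 * Om_slope 0 t)"
proof -
  have "integral {0..B} (\<lambda>t. (Om (x - t) - Om (x + t) + 2 * Om t) / t)
      = integral {0..B} (\<lambda>t. - (Om_slope x (x + t) + Om_slope x (x - t) - 2 * Om_slope 0 t))"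
    by (rule integral_spike[of "{0}"]) (auto simp: Om_slope_def field_simps)
  then show ?thesis by (simp only: integral_neg)
qed

lemma parts_bound:
  assumes x: "x > 0" and B: "B \<ge> 2 * x"
  shows "\<bar>parts x B\<bar> \<le> (4 * x\<^sup>2) / (B - x)"
proof -
  have pos: "B > 0" "B - x > 0" using x B by auto
  have l: "ln \<bar>(x\<^sup>2 - B\<^sup>2) / B\<^sup>2\<bar> = ln (B - x) + ln (x + B) - 2 * ln B"
  proof -
    have "\<bar>(x\<^sup>2 - B\<^sup>2) / B\<^sup>2\<bar> = (B - x) * (x + B) / B\<^sup>2"
    proof -
      have "x\<^sup>2 - B\<^sup>2 = - (B - x) * (x + B)" by (simp add: power2_eq_square algebra_simps)
      then show ?thesis using x pos by (simp add: abs_mult abs_divide)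
    qed
    then show ?thesis using x pos by (simp add: ln_div ln_mult ln_realpow)
  qed
  \<comment> \<open>Grouping all three logarithms against Om B uses the decay of the kernel, which
    compensates the linear growth of Om B.\<close>
  have "parts x B = Om B * ln \<bar>(x\<^sup>2 - B\<^sup>2) / B\<^sup>2\<bar> + Om x * (ln (x + B) - ln (B - x))"
    unfolding parts_def l using pos by (simp add: algebra_simps)
  then have "\<bar>parts x B\<bar> \<le> \<bar>Om B\<bar> * \<bar>ln \<bar>(x\<^sup>2 - B\<^sup>2) / B\<^sup>2\<bar>\<bar> + \<bar>Om x\<bar> * \<bar>ln (x + B) - ln (B - x)\<bar>"
    by (metis abs_mult abs_triangle_ineq)
  also have "\<bar>Om B\<bar> * \<bar>ln \<bar>(x\<^sup>2 - B\<^sup>2) / B\<^sup>2\<bar>\<bar> \<le> B * (2 * x\<^sup>2 / B\<^sup>2)"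
    using Om_abs_le[of B] pos by (intro mult_mono log_kernel_bound x B) auto
  also have "B * (2 * x\<^sup>2 / B\<^sup>2) = 2 * x\<^sup>2 / B" using pos by (simp add: power2_eq_square)
  also have "2 * x\<^sup>2 / B \<le> 2 * x\<^sup>2 / (B - x)" using pos x by (intro divide_left_mono) auto
  also have "\<bar>Om x\<bar> * \<bar>ln (x + B) - ln (B - x)\<bar> \<le> x * (2 * x / (B - x))"
  proof (intro mult_mono)
    have "ln (x + B) - ln (B - x) = ln ((x + B) / (B - x))" using pos x by (simp add: ln_div)
    also have "\<dots> \<le> (x + B) / (B - x) - 1" using pos x by (intro ln_le_minus_one) auto
    also have "\<dots> = 2 * x / (B - x)" using pos by (simp add: field_simps)
    finally have "ln (x + B) - ln (B - x) \<le> 2 * x / (B - x)" .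
    moreover have "ln (B - x) \<le> ln (x + B)" using pos x by simp
    ultimately show "\<bar>ln (x + B) - ln (B - x)\<bar> \<le> 2 * x / (B - x)" by simp
  qed (use Om_abs_le[of x] x in auto)
  also have "2 * x\<^sup>2 / (B - x) + x * (2 * x / (B - x)) = 4 * x\<^sup>2 / (B - x)"
    by (simp add: power2_eq_square flip: add_divide_distrib)
  finally show ?thesis by simp
qed

text \<open>\<open>e\<close> and \<open>f\<close> perturb numerator and denominator of Om B / B; the
  lemma is applied to slopes at points within x of B and of - B.\<close>

lemma slope_close:
  assumes "\<bar>e\<bar> \<le> 2 * x" "\<bar>f\<bar> \<le> x" "0 < x" "B \<ge> 2 * x"
  shows "\<bar>(Om B + e) / (B + f) - Om B / B\<bar> \<le> 3 * x / (B - x)"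
proof -
  have pos: "B > 0" "B - x > 0" "B + f \<ge> B - x" "B + f > 0" using assms by auto
  have "(Om B + e) / (B + f) - Om B / B = (e * B - f * Om B) / (B * (B + f))"
    using pos by (simp add: field_simps)
  then have "\<bar>(Om B + e) / (B + f) - Om B / B\<bar> = \<bar>e * B - f * Om B\<bar> / (B * (B + f))"
    using pos by (simp add: abs_divide abs_mult)
  also have "\<bar>e * B - f * Om B\<bar> \<le> \<bar>e\<bar> * B + \<bar>f\<bar> * \<bar>Om B\<bar>"
    using pos abs_triangle_ineq4[of "e * B" "f * Om B"] by (simp add: abs_mult)
  also have "\<dots> \<le> (2 * x) * B + x * B"
    using assms pos Om_abs_le[of B] by (intro add_mono mult_mono) auto
  also have "\<dots> = 3 * x * B" by simp
  also have "3 * x * B / (B * (B + f)) = 3 * x / (B + f)" using pos by simp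
  also have "\<dots> \<le> 3 * x / (B - x)" using pos assms by (intro divide_left_mono) auto
  finally show ?thesis using pos by (simp add: divide_right_mono)
qed

text \<open>With a primitive \<open>K\<close> of the slope, the translation leaves only two strips
  of width x, at B and at - B. Neither contribution is known to vanish in the limit, but by oddness
  of \<open>Om\<close> both slopes are close to Om B / B, and their difference is O(x / (B -
  x)).\<close>

lemma slope_shift_bound:
  assumes x: "x > 0" and B: "B \<ge> 2 * x"
  shows "\<bar>integral {0..B} (\<lambda>t. Om_slope x (x + t) + Om_slope x (x - t) - 2 * Om_slope 0 t)
      - integral {0..B} (\<lambda>y. Om_slope x y + Om_slope x (- y) - 2 * Om_slope 0 y)\<bar> \<le> 6 * x\<^sup>2 / (B - x)"
proof -
  have pos: "B > 0" "B - x > 0" using x B by auto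
  have "\<And>y. isCont (Om_slope x) y"
    using continuous_on_Om_slope[OF continuous_on_id, of UNIV x] by (simp add: continuous_on_eq_continuous_at)
  then obtain K where K: "\<And>y. (K has_real_derivative Om_slope x y) (at y)"
    using einterval_antiderivative[of "-\<infinity>" \<infinity> "Om_slope x"]
    by (auto simp: has_real_derivative_iff_has_vector_derivative)
  have "((\<lambda>t. (Om_slope x (x + t) + Om_slope x (x - t) - 2 * Om_slope 0 t)
        - (Om_slope x t + Om_slope x (- t) - 2 * Om_slope 0 t)) has_integral
      (K (x + B) - K (x - B) - (K B - K (- B))) - (K (x + 0) - K (x - 0) - (K 0 - K (- 0)))) {0..B}"
  proof (rule fundamental_theorem_of_calculus)
    fix t
    have "((\<lambda>t. K (x + t) - K (x - t) - (K t - K (- t))) has_real_derivative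
        (Om_slope x (x + t) + Om_slope x (x - t) - 2 * Om_slope 0 t)
        - (Om_slope x t + Om_slope x (- t) - 2 * Om_slope 0 t)) (at t within {0..B})"
      by (rule derivative_eq_intros DERIV_chain2[OF K] refl)+ simp
    then show "((\<lambda>t. K (x + t) - K (x - t) - (K t - K (- t))) has_vector_derivative
        (Om_slope x (x + t) + Om_slope x (x - t) - 2 * Om_slope 0 t)
        - (Om_slope x t + Om_slope x (- t) - 2 * Om_slope 0 t)) (at t within {0..B})"
      by (simp add: has_real_derivative_iff_has_vector_derivative)
  qed (use pos in auto)
  then have "integral {0..B} (\<lambda>t. (Om_slope x (x + t) + Om_slope x (x - t) - 2 * Om_slope 0 t)
        - (Om_slope x t + Om_slope x (- t) - 2 * Om_slope 0 t)) = K (x + B) - K (x - B) - (K B - K (- B))"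
    by (simp add: integral_unique)
  moreover have "(\<lambda>t. Om_slope x (x + t) + Om_slope x (x - t) - 2 * Om_slope 0 t) integrable_on {0..B}"
    by (intro integrable_continuous_real continuous_intros continuous_on_Om_slope)
  ultimately have eq: "integral {0..B} (\<lambda>t. Om_slope x (x + t) + Om_slope x (x - t) - 2 * Om_slope 0 t)
      - integral {0..B} (\<lambda>y. Om_slope x y + Om_slope x (- y) - 2 * Om_slope 0 y)
      = (K (x + B) - K B) - (K (x - B) - K (- B))"
    using Henstock_Kurzweil_Integration.integral_diff[OF _ slope_integrable[of x 0 B], of
        "\<lambda>t. Om_slope x (x + t) + Om_slope x (x - t) - 2 * Om_slope 0 t"] by linarith
  obtain y where y: "B < y" "y < x + B" "K (x + B) - K B = (x + B - B) * Om_slope x y"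
    using MVT2[of B "x + B" K "Om_slope x"] x K by auto
  obtain z where z: "- B < z" "z < x - B" "K (x - B) - K (- B) = (x - B - - B) * Om_slope x z"
    using MVT2[of "- B" "x - B" K "Om_slope x"] x K by auto
  have a: "\<bar>Om_slope x y - Om B / B\<bar> \<le> 3 * x / (B - x)"
  proof -
    have "Om_slope x y = (Om B + (Om y - Om B - Om x)) / (B + (y - B - x))"
      using y x B by (simp add: Om_slope_def)
    moreover have "\<bar>Om y - Om B - Om x\<bar> \<le> 2 * x"
    proof -
      have "\<bar>Om y - Om B - Om x\<bar> \<le> \<bar>Om y - Om B\<bar> + \<bar>Om x\<bar>" by simp
      also have "\<dots> \<le> x + x" using Om_lipschitz[of y B] Om_abs_le[of x] y x by (intro add_mono) auto
      finally show ?thesis by simp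
    qed
    ultimately show ?thesis using slope_close[of "Om y - Om B - Om x" x "y - B - x" B] y x B by simp
  qed
  have b: "\<bar>Om_slope x z - Om B / B\<bar> \<le> 3 * x / (B - x)"
  proof -
    have zx: "z \<noteq> x" "z - x < 0" using z x B by auto
    have "Om_slope x z = (Om B + (Om (- z) - Om B + Om x)) / (B + (x - z - B))"
    proof -
      have "(Om z - Om x) / (z - x) = (Om x - Om z) / (x - z)"
        using zx by (simp add: divide_simps) (simp add: algebra_simps)
      then show ?thesis using zx by (simp add: Om_slope_def Om_odd)
    qed
    moreover have "\<bar>Om (- z) - Om B + Om x\<bar> \<le> 2 * x"
    proof -
      have "\<bar>Om (- z) - Om B + Om x\<bar> \<le> \<bar>Om (- z) - Om B\<bar> + \<bar>Om x\<bar>" by simp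
      also have "\<dots> \<le> x + x" using Om_lipschitz[of "- z" B] Om_abs_le[of x] z x by (intro add_mono) auto
      finally show ?thesis by simp
    qed
    ultimately show ?thesis using slope_close[of "Om (- z) - Om B + Om x" x "x - z - B" B] z x B by simp
  qed
  have "\<bar>Om_slope x y - Om_slope x z\<bar> \<le> 3 * x / (B - x) + 3 * x / (B - x)"
    using a b by (simp only: abs_le_iff) linarith
  then have "x * \<bar>Om_slope x y - Om_slope x z\<bar> \<le> x * (3 * x / (B - x) + 3 * x / (B - x))"
    using x by (intro mult_left_mono) auto
  also have "\<dots> = 6 * x\<^sup>2 / (B - x)" by (simp add: power2_eq_square field_simps)
  finally have "x * \<bar>Om_slope x y - Om_slope x z\<bar> \<le> 6 * x\<^sup>2 / (B - x)" .
  moreover have "(K (x + B) - K B) - (K (x - B) - K (- B)) = x * (Om_slope x y - Om_slope x z)"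
    using y z by (simp add: algebra_simps)
  ultimately show ?thesis unfolding eq using x by (simp add: abs_mult)
qed

lemma log_ker_integral_eq_pot:
  assumes x: "x > 0"
  shows "(LBINT y:{0<..}. log_ker x y) = pot x"
proof -
  let ?I = "\<lambda>B. integral {0..B} (log_ker x)"
  let ?P = "\<lambda>B. integral {0..B} (\<lambda>t. (Om (x - t) - Om (x + t) + 2 * Om t) / t)"
  have 1: "(?I \<longlongrightarrow> (LBINT y:{0<..}. log_ker x y)) at_top"
    by (rule tendsto_integral_Icc_at_top[OF log_ker_integrable[OF x]])
  have 2: "(?P \<longlongrightarrow> pot x) at_top"
    unfolding pot_def by (rule tendsto_integral_Icc_at_top[OF pot_integrable])
  have "((\<lambda>B. ?I B - ?P B) \<longlongrightarrow> 0) at_top"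
  proof (rule Lim_null_comparison)
    have "filterlim (\<lambda>B. B - x) at_top at_top"
      using filterlim_tendsto_add_at_top[OF tendsto_const[of "- x"] filterlim_ident] by simp
    then show "((\<lambda>B. 10 * x\<^sup>2 / (B - x)) \<longlongrightarrow> 0) at_top"
      by (intro tendsto_divide_0[OF tendsto_const] filterlim_at_top_imp_at_infinity)
    show "\<forall>\<^sub>F B in at_top. norm (?I B - ?P B) \<le> 10 * x\<^sup>2 / (B - x)"
    proof (rule eventually_mono[OF eventually_ge_at_top[of "2 * x"]])
      fix B assume B: "2 * x \<le> B"
      let ?S = "integral {0..B} (\<lambda>y. Om_slope x y + Om_slope x (- y) - 2 * Om_slope 0 y)"
      let ?R = "integral {0..B} (\<lambda>t. Om_slope x (x + t) + Om_slope x (x - t) - 2 * Om_slope 0 t)"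
      have "?I B = parts x B - ?S"
        using log_ker_has_integral[OF x, of B] x B by (intro integral_unique) auto
      moreover have "?P B = - ?R" using pot_integral[of B x] x B by simp
      ultimately have eq: "?I B - ?P B = parts x B + (?R - ?S)" by simp
      have "\<bar>?I B - ?P B\<bar> \<le> \<bar>parts x B\<bar> + \<bar>?R - ?S\<bar>" unfolding eq by (rule abs_triangle_ineq)
      also have "\<dots> \<le> 4 * x\<^sup>2 / (B - x) + 6 * x\<^sup>2 / (B - x)"
        by (intro add_mono parts_bound slope_shift_bound x B)
      also have "\<dots> = 10 * x\<^sup>2 / (B - x)" by (simp flip: add_divide_distrib)
      finally show "norm (?I B - ?P B) \<le> 10 * x\<^sup>2 / (B - x)" by simp
    qed
  qed
  then have "(LBINT y:{0<..}. log_ker x y) - pot x = 0"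
    by (rule tendsto_unique[OF trivial_limit_at_top_linorder tendsto_diff[OF 1 2]])
  then show ?thesis by simp
qed

lemma pot_even: "pot (- x) = pot x"
proof -
  have "Om (- x - t) - Om (- x + t) = Om (x - t) - Om (x + t)" for t
    using Om_odd[of "x + t"] Om_odd[of "x - t"] by simp
  then show ?thesis unfolding pot_def by simp
qed

lemma Top_eq_pot: "Top w x = pot x / pi"
proof -
  have T: "Top w x = (LBINT y:{0<..}. log_ker x y) / pi"
    by (simp add: Top_def log_ker_def)
  consider "x > 0" | "x = 0" | "- x > 0" by linarith
  then show ?thesis
  proof cases
    case 1
    then show ?thesis using T log_ker_integral_eq_pot by simp
  next
    case 2
    have "log_ker x y = 0" for y by (simp add: log_ker_def 2)
    then have "(LBINT y:{0<..}. log_ker x y) = 0" by (simp add: set_lebesgue_integral_def)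
    moreover have "pot x = 0" by (simp add: pot_def 2 Om_odd)
    ultimately show ?thesis using T by simp
  next
    case 3
    have "log_ker (- x) = log_ker x" by (simp add: log_ker_def[abs_def])
    then show ?thesis using T log_ker_integral_eq_pot[OF 3] pot_even by simp
  qed
qed

lemma Top_deriv: "(Top w has_real_derivative hil x / pi) (at x)"
  unfolding Top_eq_pot[abs_def] by (rule DERIV_cdivide[OF pot_deriv])

end

section \<open>Fixed points\<close>

text \<open>\<open>test_fun\<close> asks for compact support of \<open>fs 0\<close> alone; the
  derivatives vanish off K too because the complement of K is open.\<close>

lemma test_fun_support:
  assumes "test_fun fs"
  obtains R where "R > 0" "\<And>j x. R \<le> \<bar>x\<bar> \<Longrightarrow> fs j x = 0"
proof -
  obtain K where K: "compact K" "\<And>x. x \<notin> K \<Longrightarrow> fs 0 x = 0"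
    and der: "\<And>n x. (fs n has_real_derivative fs (Suc n) x) (at x)"
    using assms unfolding test_fun_def by blast
  obtain B where B: "\<And>x. x \<in> K \<Longrightarrow> \<bar>x\<bar> \<le> B"
    using compact_imp_bounded[OF K(1)] by (auto simp: bounded_iff)
  have "\<forall>x\<in>- K. fs j x = 0" for j
  proof (induction j)
    case (Suc j)
    show ?case
    proof
      fix x assume x: "x \<in> - K"
      have "((\<lambda>x. 0) has_real_derivative fs (Suc j) x) (at x)"
        by (rule has_field_derivative_transform_within_open[OF der[of j x] _ x])
          (use Suc K(1) compact_imp_closed in \<open>auto simp: open_Compl\<close>)
      then show "fs (Suc j) x = 0" using DERIV_unique DERIV_const by blast
    qed
  qed (use K in auto)
  then have "fs j x = 0" if "\<bar>B\<bar> + 1 \<le> \<bar>x\<bar>" for j x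
    using B[of x] that by fastforce
  then show thesis by (rule that[of "\<bar>B\<bar> + 1", rotated]) auto
qed

lemma integral_by_parts_test_fun:
  fixes u u' :: "real \<Rightarrow> real"
  assumes u: "\<And>x. (u has_real_derivative u' x) (at x)" and cont: "continuous_on UNIV u'"
    and fs: "test_fun fs"
  shows "(LINT x|lborel. u x * fs (Suc j) x) = - (LINT x|lborel. u' x * fs j x)"
proof -
  obtain R where R: "R > 0" "\<And>j x. R \<le> \<bar>x\<bar> \<Longrightarrow> fs j x = 0"
    using test_fun_support[OF fs] by metis
  have der: "(fs n has_real_derivative fs (Suc n) x) (at x)" for n x
    using fs unfolding test_fun_def by blast
  have c: "continuous_on A (fs n)" "continuous_on A u" "continuous_on A u'" for n A
    by (rule DERIV_continuous_on[OF has_field_derivative_at_within[OF der]],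
        rule DERIV_continuous_on[OF has_field_derivative_at_within[OF u]],
        rule continuous_on_subset[OF cont subset_UNIV])
  have int: "integrable lborel (\<lambda>x. v x * fs n x)" if "continuous_on {-R..R} v" for v n
  proof -
    have "set_integrable lborel {-R..R} (\<lambda>x. v x * fs n x)"
      by (intro borel_integrable_atLeastAtMost' continuous_intros that c)
    moreover have "indicator {-R..R} x *\<^sub>R (v x * fs n x) = v x * fs n x" for x
      using R(2)[of x n] by (cases "\<bar>x\<bar> \<le> R") (auto simp: indicator_def)
    ultimately show ?thesis by (simp only: set_integrable_def)
  qed
  have "(LINT x|lborel. (u x * fs (Suc j) x + u' x * fs j x) * indicator {-R..R} x) = u R * fs j R - u (- R) * fs j (- R)"
  proof (rule integral_FTC_Icc_real)
    show "((\<lambda>x. u x * fs j x) has_real_derivative u x * fs (Suc j) x + u' x * fs j x) (at x)" for x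
      using DERIV_mult[OF u[of x] der[of j x]] by (simp add: add.commute mult.commute)
    have "continuous_on UNIV (\<lambda>x. u x * fs (Suc j) x + u' x * fs j x)" by (intro continuous_intros c)
    then show "isCont (\<lambda>x. u x * fs (Suc j) x + u' x * fs j x) x" for x
      by (simp add: continuous_on_eq_continuous_at)
  qed (use R in auto)
  moreover have "(u x * fs (Suc j) x + u' x * fs j x) * indicator {-R..R} x = u x * fs (Suc j) x + u' x * fs j x" for x
    using R(2)[of x] by (cases "\<bar>x\<bar> \<le> R") (auto simp: indicator_def)
  ultimately have "(LINT x|lborel. u x * fs (Suc j) x + u' x * fs j x) = u R * fs j R - u (- R) * fs j (- R)"
    by (simp only:)
  also have "\<dots> = 0" using R(2)[of R j] R(2)[of "- R" j] R(1) by simp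
  finally have "(LINT x|lborel. u x * fs (Suc j) x + u' x * fs j x) = 0" .
  moreover have "(LINT x|lborel. u x * fs (Suc j) x + u' x * fs j x)
      = (LINT x|lborel. u x * fs (Suc j) x) + (LINT x|lborel. u' x * fs j x)"
    by (intro Bochner_Integration.integral_add int c)
  ultimately show ?thesis by simp
qed

text \<open>Convexity is applied to the chord from s = 0, where the value is 1, to s = y^2, at the
  intermediate point x^2. Bounding 1 - w x by x^2 or by 1 then gives the two slope
  estimates.\<close>

lemma profile_Dset:
  assumes "w \<in> Dset a"
  shows "profile w"
proof -
  have D: "continuous_on UNIV w" "\<And>x. w (- x) = w x" "w 0 = 1" "\<And>x. max 0 (1 - x\<^sup>2) \<le> w x" "\<And>x. w x \<le> 1"
    "\<And>x y. 0 \<le> x \<Longrightarrow> x \<le> y \<Longrightarrow> w y \<le> w x" "convex_on {0..} (\<lambda>s. w (sqrt s))"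
    using assms unfolding Dset_def by auto
  have key: "x\<^sup>2 * (w x - w y) \<le> (y\<^sup>2 - x\<^sup>2) * (1 - w x)" if "0 < x" "x \<le> y" for x y
  proof -
    define l where "l = x\<^sup>2 / y\<^sup>2"
    have y: "y > 0" using that by simp
    have sq: "x\<^sup>2 \<le> y\<^sup>2" using that by (intro power_mono) auto
    then have l: "0 \<le> l" "l \<le> 1" using y by (auto simp: l_def divide_simps)
    have "w (sqrt ((1 - l) *\<^sub>R 0 + l *\<^sub>R y\<^sup>2)) \<le> (1 - l) * w (sqrt 0) + l * w (sqrt (y\<^sup>2))"
      by (rule convex_onD[OF D(7)]) (use l in auto)
    then have "w x \<le> (1 - l) + l * w y" using y that D(3) by (simp add: l_def)
    then have "y\<^sup>2 * w x \<le> y\<^sup>2 * ((1 - l) + l * w y)" by (intro mult_left_mono) auto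
    also have "\<dots> = y\<^sup>2 - x\<^sup>2 + x\<^sup>2 * w y" using y by (simp add: l_def field_simps)
    finally show ?thesis by (simp add: algebra_simps)
  qed
  show ?thesis
  proof
    show "0 \<le> w x" for x using D(4)[of x] by simp
    show "w x - w y \<le> y\<^sup>2 - x\<^sup>2" if xy: "0 \<le> x" "x \<le> y" for x y
    proof (cases "x = 0")
      case True
      then show ?thesis using D(3) D(4)[of y] by simp
    next
      case False
      have sq: "x\<^sup>2 \<le> y\<^sup>2" using xy by (intro power_mono) auto
      have "x\<^sup>2 * (w x - w y) \<le> (y\<^sup>2 - x\<^sup>2) * (1 - w x)" using key xy False by simp
      also have "\<dots> \<le> (y\<^sup>2 - x\<^sup>2) * x\<^sup>2" using sq D(4)[of x] by (intro mult_left_mono) auto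
      finally have "x\<^sup>2 * (w x - w y) \<le> x\<^sup>2 * (y\<^sup>2 - x\<^sup>2)" by (simp add: mult.commute)
      then show ?thesis using False by (simp add: mult_le_cancel_left)
    qed
    show "w x - w y \<le> (y\<^sup>2 - x\<^sup>2) / x\<^sup>2" if xy: "0 < x" "x \<le> y" for x y
    proof -
      have sq: "x\<^sup>2 \<le> y\<^sup>2" using xy by (intro power_mono) auto
      have "0 \<le> w x" using D(4)[of x] by simp
      then have "(y\<^sup>2 - x\<^sup>2) * (1 - w x) \<le> (y\<^sup>2 - x\<^sup>2) * 1" using sq by (intro mult_left_mono) auto
      then have "x\<^sup>2 * (w x - w y) \<le> y\<^sup>2 - x\<^sup>2" using key[OF xy] by simp
      then show ?thesis using xy by (simp add: pos_le_divide_eq mult.commute)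
    qed
  qed (use D in auto)
qed

text \<open>If w (1 / 2) = 1, monotonicity and w \<le> 1 make w constant on [0, 1 / 2], so the left
  derivative there would be 0 and not at most - eta a.\<close>

lemma Dset_half_less_1:
  assumes "w \<in> Dset a"
  shows "w (1 / 2) < 1"
proof (rule ccontr)
  assume "\<not> w (1 / 2) < 1"
  moreover have mono: "\<And>x y. 0 \<le> x \<Longrightarrow> x \<le> y \<Longrightarrow> w y \<le> w x" and le: "\<And>x. w x \<le> 1"
    using assms unfolding Dset_def by auto
  ultimately have half: "w (1 / 2) = 1" by (metis less_eq_real_def)
  obtain L where L: "((\<lambda>h. (w (1/2 + h) - w (1/2)) / h) \<longlongrightarrow> L) (at_left 0)" "L \<le> - eta a"
    using assms unfolding Dset_def by blast
  have "\<forall>\<^sub>F h in at_left 0. (w (1/2 + h) - w (1/2)) / h = 0"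
    unfolding eventually_at_left_field
  proof (intro exI[of _ "- 1 / 2"] conjI allI impI)
    fix h :: real assume "- 1 / 2 < h" "h < 0"
    then have "w (1 / 2) \<le> w (1 / 2 + h)" by (intro mono) auto
    then show "(w (1/2 + h) - w (1/2)) / h = 0" using half le[of "1 / 2 + h"] by simp
  qed auto
  from Lim_transform_eventually[OF L(1) this] have "L = 0" by (simp add: tendsto_const_iff)
  moreover have "eta a > 0" unfolding eta_def by (simp add: add_pos_nonneg)
  ultimately show False using L(2) by simp
qed

section \<open>Differentiating the fixed point equation\<close>

locale fixed_point = profile +
  fixes a :: real
  assumes a_nz: "a \<noteq> 0"
    and fixed: "Ra a w x = ereal (w x)"
    and w_0: "w 0 = 1"
    and w_lower: "1 - x\<^sup>2 \<le> w x"
    and w_half: "w (1 / 2) < 1"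
begin

definition base :: "real \<Rightarrow> real" where
  "base x = 1 - a * Top w x / rfun w"

lemma w_eq_base: "base x > 0 \<Longrightarrow> w x = base x powr (1 / a)"
  using fixed[of x] by (simp add: Ra_def Let_def flip: base_def)

lemma base_pos: "w x > 0 \<Longrightarrow> base x > 0"
  using fixed[of x] by (auto simp: Ra_def Let_def zero_ereal_def simp flip: base_def split: if_splits)

text \<open>A base that is not positive would make \<open>Ra\<close> infinite, which the real value
  w x excludes.\<close>

lemma w_pos_neg: "a < 0 \<Longrightarrow> w x > 0"
proof -
  assume "a < 0"
  then have "base x > 0"
    using fixed[of x] by (auto simp: Ra_def Let_def simp flip: base_def split: if_splits)
  then show ?thesis using w_eq_base by simp
qed

lemma rfun_pos: "rfun w > 0"
proof -
  have "0 \<le> (LBINT y:{0<..}. (w 0 - w y) / y\<^sup>2)"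
    unfolding set_lebesgue_integral_def
    by (rule Bochner_Integration.integral_nonneg) (use w_le_1 w_0 in \<open>auto simp: indicator_def\<close>)
  then have "0 \<le> rfun w" by (simp add: rfun_def)
  moreover have "rfun w \<noteq> 0"
  proof
    assume "rfun w = 0"
    \<comment> \<open>Division by zero yields 0, so \<open>base\<close> would be identically 1; no
      analysis of the integral defining \<open>rfun\<close> is needed.\<close>
    then have "w (1 / 2) = 1" using w_eq_base[of "1 / 2"] by (simp add: base_def)
    then show False using w_half by simp
  qed
  ultimately show ?thesis by simp
qed

definition kap :: real where
  "kap = 1 / (pi * rfun w)"

lemma kap_pos: "kap > 0"
  using rfun_pos by (simp add: kap_def)

text \<open>Stated for every exponent because differentiation turns q into q - a, to which the
  formula has to be applied again.\<close>

lemma w_powr_deriv: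
  assumes "w x > 0"
  shows "((\<lambda>x. w x powr q) has_real_derivative - (q * kap) * (w x powr (q - a) * hil x)) (at x)"
proof -
  have bd: "(base has_real_derivative - a * kap * hil x) (at x)" for x
    unfolding base_def
    by (rule DERIV_cong[OF DERIV_diff[OF DERIV_const DERIV_cdivide[OF DERIV_cmult[OF Top_deriv]]]])
      (simp add: kap_def)
  have b: "base x > 0" using base_pos[OF assms] .
  have "isCont base x" using bd DERIV_isCont by blast
  \<comment> \<open>Positivity of \<open>base\<close> is an open condition, so w^q agrees with a
    power of \<open>base\<close> near x and not only at x.\<close>
  then have "\<forall>\<^sub>F y in nhds x. base y > 0"
    using b by (simp add: isCont_def tendsto_at_iff_tendsto_nhds order_tendstoD)
  then have ev: "\<forall>\<^sub>F y in nhds x. base y powr (q / a) = w y powr q"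
    by (rule eventually_mono) (simp add: w_eq_base powr_powr)
  have "((\<lambda>x. base x powr (q / a)) has_real_derivative (q / a) * base x powr (q / a - 1) * (- a * kap * hil x)) (at x)"
    by (rule DERIV_chain2[OF has_real_derivative_powr[OF b] bd])
  moreover have "base x powr (q / a - 1) = w x powr (q - a)"
    using a_nz by (simp add: w_eq_base[OF b] powr_powr diff_divide_distrib)
  ultimately have "((\<lambda>x. base x powr (q / a)) has_real_derivative - (q * kap) * (w x powr (q - a) * hil x)) (at x)"
    using a_nz by (simp add: mult_ac)
  then show ?thesis using DERIV_cong_ev[OF refl ev refl] by simp
qed

lemma w_deriv:
  assumes "w x > 0"
  shows "(w has_real_derivative - kap * (w x powr (1 - a) * hil x)) (at x)"
  using w_powr_deriv[OF assms, of 1] w_nonneg by simp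

text \<open>\<open>Q\<close> is a stock of exponents closed under q -> q - a on which w^q is
  bounded: the positive reals for a < 0, all reals where w is bounded below. The bound
  \<open>k \<le> Suc n\<close> is the gain of one derivative over \<open>hil\<close>.\<close>

lemma hoelder_C_powr:
  assumes S: "convex S" "\<And>x. x \<in> S \<Longrightarrow> w x > 0"
    and Q: "\<And>q. q \<in> Q \<Longrightarrow> q - a \<in> Q"
    and bnd: "\<And>q. q \<in> Q \<Longrightarrow> \<exists>B. \<forall>x\<in>S. w x powr q \<le> B"
    and hil: "hoelder_C n S hil"
  shows "k \<le> Suc n \<Longrightarrow> q \<in> Q \<Longrightarrow> hoelder_C k S (\<lambda>x. w x powr q)"
proof (induction k arbitrary: q)
  have *: "hoelder_bdd S (\<lambda>x. w x powr q)" if q: "q \<in> Q" for q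
  proof -
    obtain B where B: "\<And>x. x \<in> S \<Longrightarrow> w x powr q \<le> B" using bnd[OF q] by blast
    obtain B' where B': "\<And>x. x \<in> S \<Longrightarrow> w x powr (q - a) \<le> B'" using bnd[OF Q[OF q]] by blast
    show ?thesis
    proof (rule hoelder_bdd_deriv_bounded[OF S(1) _ w_powr_deriv[OF S(2)]])
      show "\<bar>w x powr q\<bar> \<le> B" if "x \<in> S" for x using B[OF that] by simp
      show "\<bar>- (q * kap) * (w x powr (q - a) * hil x)\<bar> \<le> \<bar>q * kap\<bar> * (B' * 40)" if "x \<in> S" for x
      proof -
        have "0 \<le> B'" using B'[OF that] powr_ge_zero[of "w x" "q - a"] by linarith
        then show ?thesis
          unfolding abs_mult[of "- (q * kap)"] abs_mult[of "w x powr (q - a)"] abs_minus_cancel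
          using B'[OF that] hil_bounded[of x] by (intro mult_left_mono mult_mono) auto
      qed
    qed
  qed
  case 0
  then show ?case using * by simp
next
  case (Suc k)
  have "hoelder_C k S (\<lambda>x. - (q * kap) * (w x powr (q - a) * hil x))"
    using Suc Q by (intro hoelder_C_cmult hoelder_C_mult hoelder_C_mono[OF _ hil]) auto
  moreover have "hoelder_bdd S (\<lambda>x. w x powr q)"
    using Suc.IH[of q] Suc.prems hoelder_C_bdd by auto
  ultimately show ?case
    using w_powr_deriv S(2) by (intro hoelder_C_SucI) auto
qed

lemma hoelder_C_improve:
  assumes "open S" "convex S" "\<And>x. x \<in> S \<Longrightarrow> w x > 0"
    and "\<And>q. q \<in> Q \<Longrightarrow> q - a \<in> Q" "1 \<in> Q"
    and "\<And>q. q \<in> Q \<Longrightarrow> \<exists>B. \<forall>x\<in>S. w x powr q \<le> B"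
    and "hoelder_C n S hil"
  shows "hoelder_C (Suc n) S w"
proof -
  have "hoelder_C (Suc n) S (\<lambda>x. w x powr 1)"
    by (rule hoelder_C_powr[of S Q n]) (use assms in auto)
  then show ?thesis using w_nonneg by simp
qed

text \<open>This is the function called M in the overview, with the integral carried out.\<close>

definition excess :: "real \<Rightarrow> real" where
  "excess x = Om x - x * w x"

text \<open>w is at least 1 - e^2 on [0, e] and at least w 1 on [e, 1], so its integral over [0, 1]
  exceeds w 1 as soon as e^2 < 1 - w 1.\<close>

lemma excess_1_pos: "excess 1 > 0"
proof -
  define c where "c = 1 - w 1"
  have c: "0 < c" "c \<le> 1" using w_half w_antimono[of "1/2" 1] w_nonneg[of 1] by (auto simp: c_def)
  \<comment> \<open>With e^2 = c / 4 the gain is e * (1 - e^2 - w 1) = e * (3 / 4) * c.\<close>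
  define e where "e = sqrt c / 2"
  have "sqrt c \<le> 1" using c by simp
  then have "e < 1" unfolding e_def by linarith
  then have e: "0 < e" "e < 1" "e\<^sup>2 = c / 4" using c by (simp_all add: e_def power_divide)
  obtain y where y: "0 < y" "y < e" "Om e - Om 0 = (e - 0) * w y"
    using MVT2[of 0 e Om w] e Om_deriv by auto
  obtain z where z: "e < z" "z < 1" "Om 1 - Om e = (1 - e) * w z"
    using MVT2[of e 1 Om w] e Om_deriv by auto
  have "e * (1 - e\<^sup>2) \<le> e * w y"
    using e y w_lower[of e] w_antimono[of y e] by (intro mult_left_mono) auto
  moreover have "(1 - e) * w 1 \<le> (1 - e) * w z"
    using e z w_antimono[of z 1] by (intro mult_left_mono) auto
  ultimately have "e * (1 - e\<^sup>2) + (1 - e) * w 1 \<le> Om 1" using y(3) z(3) Om_0 unfolding diff_0_right by linarith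
  moreover have "e * (1 - e\<^sup>2) + (1 - e) * w 1 - w 1 = e * (3 / 4 * c)"
    unfolding e(3) c_def by (simp add: field_simps)
  moreover have "0 < e * (3 / 4 * c)" using e c by simp
  ultimately have "w 1 < Om 1" by linarith
  then show ?thesis by (simp add: excess_def)
qed

text \<open>Monotonicity of w and the mean value theorem for \<open>Om\<close> suffice;
  differentiability of w is only known where w is positive.\<close>

lemma excess_ge: "x \<ge> 1 \<Longrightarrow> excess 1 \<le> excess x"
proof (cases "x = 1")
  case False
  assume "x \<ge> 1"
  then have x: "x > 1" using False by simp
  obtain z where z: "1 < z" "z < x" "Om x - Om 1 = (x - 1) * w z"
    using MVT2[of 1 x Om w] x Om_deriv by auto
  have "(x - 1) * w x \<le> (x - 1) * w z" using x z w_antimono[of z x] by (intro mult_left_mono) auto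
  then show ?thesis using z w_antimono[of 1 x] x by (simp add: excess_def algebra_simps)
qed simp

lemma excess_le: "x \<ge> 0 \<Longrightarrow> excess x \<le> x"
  unfolding excess_def using Om_abs_le[of x] mult_nonneg_nonneg[OF _ w_nonneg, of x x] by linarith

lemma hil_ge_excess: "x > 0 \<Longrightarrow> hil x \<ge> excess x / x"
  using hil_lower by (simp add: excess_def)

text \<open>Since \<open>excess' = - x * w'\<close> and \<open>hil \<ge> excess / x\<close>, the logarithmic derivative of \<open>excess\<close>
  dominates a multiple of \<open>w powr (1 - a)\<close>, while \<open>excess\<close> itself grows at most linearly.\<close>

lemma w_powr_decay:
  assumes a: "a < 0" and x: "x \<ge> 2"
  shows "kap * (x / 2) * w x powr (1 - a) \<le> ln x - ln (excess 1)"
proof -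
  have ex: "excess y > 0" if "y \<ge> 1" for y using excess_1_pos excess_ge[OF that] by linarith
  have dex: "(excess has_real_derivative y * (kap * (w y powr (1 - a) * hil y))) (at y)" for y
    unfolding excess_def
    by (rule DERIV_cong[OF DERIV_diff[OF Om_deriv DERIV_mult[OF DERIV_ident w_deriv[OF w_pos_neg[OF a]]]]]) simp
  have "((\<lambda>y. ln (excess y)) has_real_derivative
      1 / excess y * (y * (kap * (w y powr (1 - a) * hil y)))) (at y)" if "y \<ge> 1" for y
    using DERIV_chain2[OF DERIV_ln_divide[OF ex[OF that]] dex] by simp
  \<comment> \<open>The interval [x / 2, x] gives the factor x / 2, stays to the right of 1, and
    lets monotonicity replace w y by the smaller w x.\<close>
  then obtain y where y: "x / 2 < y" "y < x" and mvt: "ln (excess x) - ln (excess (x / 2))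
      = (x - x / 2) * (1 / excess y * (y * (kap * (w y powr (1 - a) * hil y))))"
    using MVT2[of "x / 2" x "\<lambda>y. ln (excess y)" "\<lambda>y. 1 / excess y * (y * (kap * (w y powr (1 - a) * hil y)))"] x
    by auto
  have y1: "y > 1" using y x by simp
  have "kap * w x powr (1 - a) \<le> kap * w y powr (1 - a)"
    using kap_pos a y y1 w_antimono[of y x] w_nonneg[of x] by (intro mult_left_mono powr_mono2) auto
  also have "\<dots> = 1 / excess y * (y * (kap * (w y powr (1 - a) * (excess y / y))))"
    using ex[of y] y1 by simp
  also have "\<dots> \<le> 1 / excess y * (y * (kap * (w y powr (1 - a) * hil y)))"
    using ex[of y] y1 kap_pos hil_ge_excess[of y] by (intro mult_left_mono) auto
  finally have "(x / 2) * (kap * w x powr (1 - a)) \<le> (x / 2) * (1 / excess y * (y * (kap * (w y powr (1 - a) * hil y))))"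
    using x by (intro mult_left_mono) auto
  also have "\<dots> = ln (excess x) - ln (excess (x / 2))" using mvt by simp
  also have "\<dots> \<le> ln x - ln (excess 1)"
    using ex[of x] ex[of "x / 2"] excess_1_pos excess_le[of x] excess_ge[of "x / 2"] x by (intro diff_mono) auto
  finally show ?thesis by (simp add: mult_ac)
qed

text \<open>The logarithm is absorbed into x^(1/4): then w^(1 - a) = O(x^(-3/4)), whose square is
  still integrable at infinity.\<close>

lemma w_powr_decay':
  assumes a: "a < 0"
  obtains C where "\<And>x. x \<ge> 2 \<Longrightarrow> (w x powr (1 - a))\<^sup>2 \<le> C * x powr (-3/2)"
proof -
  define D where "D = (4 + \<bar>ln (excess 1)\<bar>) * 2 / kap"
  have "(w x powr (1 - a))\<^sup>2 \<le> D\<^sup>2 * x powr (-3/2)" if x: "x \<ge> 2" for x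
  proof -
    have q: "1 \<le> x powr (1/4)" using x by (simp add: ge_one_powr_ge_zero)
    have "ln x = 4 * ln (x powr (1/4))" using x by (simp add: ln_powr)
    also have "\<dots> \<le> 4 * x powr (1/4)"
      using ln_le_minus_one[of "x powr (1/4)"] x by simp
    finally have l: "ln x \<le> 4 * x powr (1/4)" .
    have "\<bar>ln (excess 1)\<bar> * 1 \<le> \<bar>ln (excess 1)\<bar> * x powr (1/4)" using q by (intro mult_left_mono) auto
    then have "ln x - ln (excess 1) \<le> (4 + \<bar>ln (excess 1)\<bar>) * x powr (1/4)"
      using l by (simp add: algebra_simps)
    then have "kap * (x / 2) * w x powr (1 - a) \<le> (4 + \<bar>ln (excess 1)\<bar>) * x powr (1/4)"
      using w_powr_decay[OF a x] by linarith
    then have "w x powr (1 - a) \<le> D * (x powr (1/4) / x)"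
      using kap_pos x by (simp add: D_def field_simps)
    also have "x powr (1/4) / x = x powr (-3/4)"
      using x powr_diff[of x "1/4" 1] by simp
    finally have "(w x powr (1 - a))\<^sup>2 \<le> (D * x powr (-3/4))\<^sup>2"
      by (intro power_mono) auto
    also have "\<dots> = D\<^sup>2 * (x powr (-3/4) * x powr (-3/4))" by (simp add: power2_eq_square mult_ac)
    also have "x powr (-3/4) * x powr (-3/4) = x powr (-3/2)" by (simp add: powr_add[symmetric])
    finally show ?thesis .
  qed
  then show thesis by (rule that)
qed

lemma w_powr_sq_integrable:
  assumes a: "a < 0"
  shows "integrable lborel (\<lambda>x. (w x powr (1 - a))\<^sup>2)"
proof -
  let ?f = "\<lambda>x. (w x powr (1 - a))\<^sup>2"
  have cont: "continuous_on A ?f" for A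
    using w_pos_neg[OF a] by (intro continuous_intros continuous_on_subset[OF w_cont]) (auto simp: less_imp_neq[symmetric])
  obtain C where C: "\<And>x. x \<ge> 2 \<Longrightarrow> ?f x \<le> C * x powr (-3/2)" using w_powr_decay'[OF a] by metis
  have 1: "set_integrable lborel {2<..} ?f"
  proof (rule set_integrable_continuous_dominated[OF _ _ cont])
    show "set_integrable lborel {2<..} (\<lambda>x. C * x powr (-3/2))"
      by (intro set_integrable_mult_right set_integrable_powr_Ioi) auto
  qed (use C in auto)
  have 2: "set_integrable lborel {-2..2} ?f"
    by (rule borel_integrable_atLeastAtMost'[OF cont])
  have 3: "set_integrable lborel {..<-2} ?f"
  proof -
    have "integrable lborel (\<lambda>x. (\<lambda>x. indicator {2<..} x *\<^sub>R ?f x) (0 + (-1) * x))"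
      using 1 unfolding set_integrable_def by (intro lborel_integrable_real_affine) auto
    moreover have "(\<lambda>x. indicator {2<..} x *\<^sub>R ?f x) (0 + (-1) * x) = indicator {..<-2} x *\<^sub>R ?f x" for x :: real
      by (auto simp: indicator_def w_even)
    ultimately show ?thesis unfolding set_integrable_def by simp
  qed
  have "set_integrable lborel ({..<-2} \<union> {-2..2} \<union> {2<..}) ?f"
    by (intro set_integrable_Un 1 2 3) auto
  moreover have "{..<-2} \<union> {-2..2} \<union> {2<..} = (UNIV :: real set)" by auto
  ultimately show ?thesis by (simp add: set_integrable_def)
qed

section \<open>Smoothness and Sobolev regularity for negative a\<close>

lemma hoelder_C_w_neg:
  assumes a: "a < 0"
  shows "hoelder_C n UNIV w"
proof (induction n)
  case (Suc n)
  have "hoelder_C n UNIV hil"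
    by (rule hoelder_C_hil[of UNIV 1 UNIV]) (use Suc in auto)
  moreover have "w x powr q \<le> 1" if "0 < q" for x q
    using w_nonneg w_le_1 that by (simp add: powr_le1)
  ultimately show ?case
    using a w_pos_neg[OF a] by (intro hoelder_C_improve[of UNIV "{0<..}"]) auto
qed (simp add: hoelder_bdd_w)

lemma hoelder_C_hil_neg: "a < 0 \<Longrightarrow> hoelder_C n UNIV hil"
  by (rule hoelder_C_hil[of UNIV 1 UNIV]) (auto intro: hoelder_C_w_neg)

lemma hoelder_C_powr_neg:
  assumes a: "a < 0" and q: "0 < q"
  shows "hoelder_C n UNIV (\<lambda>x. w x powr q)"
proof (rule hoelder_C_powr[of UNIV "{0<..}" n])
  show "\<exists>B. \<forall>x\<in>UNIV. w x powr q \<le> B" if "q \<in> {0<..}" for q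
    using w_nonneg w_le_1 that by (intro exI[of _ 1]) (simp add: powr_le1)
qed (use a q w_pos_neg[OF a] hoelder_C_hil_neg in auto)

text \<open>Differentiating w^(1 - a) gives w^(1 - 2a) = w^(1 - a) * w^(- a), up to bounded smooth
  factors. As - a > 0, the last power has bounded derivatives of all orders and joins
  \<open>g\<close>, so the decaying factor survives every differentiation.\<close>

lemma higher_deriv_factor:
  assumes a: "a < 0"
  shows "\<exists>g. (\<forall>n. hoelder_C n UNIV g) \<and> (\<forall>x. (deriv ^^ Suc j) w x = w x powr (1 - a) * g x)"
proof (induction j)
  case 0
  have "deriv w x = w x powr (1 - a) * (- kap * hil x)" for x
    using DERIV_imp_deriv[OF w_deriv[OF w_pos_neg[OF a]]] by simp
  then show ?case
    using hoelder_C_cmult[OF hoelder_C_hil_neg[OF a], of _ "- kap"] by (intro exI[of _ "\<lambda>x. - kap * hil x"]) auto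
next
  case (Suc j)
  then obtain g where g: "\<And>n. hoelder_C n UNIV g" "\<And>x. (deriv ^^ Suc j) w x = w x powr (1 - a) * g x"
    by blast
  let ?h = "\<lambda>x. deriv g x + - ((1 - a) * kap) * (w x powr (- a) * (hil x * g x))"
  have "hoelder_C n UNIV ?h" for n
    using a hoelder_C_deriv[OF open_UNIV g(1)]
    by (intro hoelder_C_add hoelder_C_cmult hoelder_C_mult hoelder_C_powr_neg hoelder_C_hil_neg g) auto
  moreover have "(deriv ^^ Suc (Suc j)) w x = w x powr (1 - a) * ?h x" for x
  proof -
    have dg: "(g has_real_derivative deriv g x) (at x)"
      using hoelder_C_higher_deriv[OF open_UNIV g(1)[of 1], of 0 x] by simp
    have "(deriv ^^ Suc j) w = (\<lambda>x. w x powr (1 - a) * g x)" using g(2) by blast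
    then have "(deriv ^^ Suc (Suc j)) w x = deriv (\<lambda>x. w x powr (1 - a) * g x) x" by simp
    also have "\<dots> = - ((1 - a) * kap) * (w x powr (1 - a - a) * hil x) * g x + deriv g x * w x powr (1 - a)"
      by (rule DERIV_imp_deriv[OF DERIV_mult[OF w_powr_deriv[OF w_pos_neg[OF a]] dg]])
    also have "w x powr (1 - a - a) = w x powr (1 - a) * w x powr (- a)"
      by (simp add: powr_add[symmetric])
    finally show ?thesis by (simp add: algebra_simps)
  qed
  ultimately show ?case by blast
qed

lemma higher_deriv_neg:
  assumes a: "a < 0"
  shows "((deriv ^^ j) w has_real_derivative (deriv ^^ Suc j) w x) (at x)"
  using hoelder_C_higher_deriv[OF open_UNIV hoelder_C_w_neg[OF a, of "Suc j"]] by simp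

lemma continuous_higher_deriv_neg:
  assumes a: "a < 0"
  shows "continuous_on A ((deriv ^^ j) w)"
  by (rule DERIV_continuous_on[OF has_field_derivative_at_within[OF higher_deriv_neg[OF a]]])

lemma L2_higher_deriv:
  assumes a: "a < 0"
  shows "L2 ((deriv ^^ Suc j) w)"
proof -
  obtain g where g: "\<And>n. hoelder_C n UNIV g" "\<And>x. (deriv ^^ Suc j) w x = w x powr (1 - a) * g x"
    using higher_deriv_factor[OF a, of j] by blast
  obtain B where B: "\<And>x. \<bar>g x\<bar> \<le> B"
    using hoelder_C_bdd[OF g(1)[of 0]] unfolding hoelder_bdd_def by auto
  have meas: "(deriv ^^ Suc j) w \<in> borel_measurable borel"
    by (rule borel_measurable_continuous_onI[OF continuous_higher_deriv_neg[OF a]])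
  have "integrable lborel (\<lambda>x. ((deriv ^^ Suc j) w x)\<^sup>2)"
  proof (rule Bochner_Integration.integrable_bound)
    show "integrable lborel (\<lambda>x. B\<^sup>2 * (w x powr (1 - a))\<^sup>2)"
      by (intro integrable_mult_right w_powr_sq_integrable a)
    show "(\<lambda>x. ((deriv ^^ Suc j) w x)\<^sup>2) \<in> borel_measurable lborel" using meas by simp
    have "(g x)\<^sup>2 \<le> B\<^sup>2" for x using B[of x] abs_le_square_iff[of "g x" B] by auto
    then have "((deriv ^^ Suc j) w x)\<^sup>2 \<le> B\<^sup>2 * (w x powr (1 - a))\<^sup>2" for x
      unfolding g(2) power_mult_distrib by (subst mult.commute) (simp add: mult_right_mono)
    then show "AE x in lborel. norm (((deriv ^^ Suc j) w x)\<^sup>2) \<le> norm (B\<^sup>2 * (w x powr (1 - a))\<^sup>2)"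
      by (auto simp: order.trans[OF _ abs_ge_self])
  qed
  then show ?thesis using meas by (simp add: L2_def)
qed

lemma weak_deriv_w:
  assumes a: "a < 0"
  shows "weak_deriv w (deriv w)"
proof -
  have "set_integrable lborel {b..c} (deriv w)" for b c
    using continuous_higher_deriv_neg[OF a, of _ 1] by (intro borel_integrable_atLeastAtMost') simp
  moreover have "(LINT x|lborel. w x * fs 1 x) = - (LINT x|lborel. deriv w x * fs 0 x)" if "test_fun fs" for fs
    using integral_by_parts_test_fun[of w "deriv w" fs 0] higher_deriv_neg[OF a, of 0]
      continuous_higher_deriv_neg[OF a, of UNIV 1] that by simp
  ultimately show ?thesis by (simp add: weak_deriv_def)
qed

lemma sobolev_deriv_w:
  assumes a: "a < 0"
  shows "sobolev_H k (deriv w)"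
proof -
  \<comment> \<open>Each integration by parts moves one derivative onto w, so the induction must
    allow any starting order i.\<close>
  have "(LINT x|lborel. (deriv ^^ Suc i) w x * fs (j + l) x) = (-1) ^ j * (LINT x|lborel. (deriv ^^ Suc (i + j)) w x * fs l x)"
    if "test_fun fs" for fs i j l
  proof (induction j arbitrary: i)
    case (Suc j)
    have "(LINT x|lborel. (deriv ^^ Suc i) w x * fs (Suc (j + l)) x) = - (LINT x|lborel. (deriv ^^ Suc (Suc i)) w x * fs (j + l) x)"
      by (rule integral_by_parts_test_fun[OF higher_deriv_neg[OF a] continuous_higher_deriv_neg[OF a] that])
    then show ?case using Suc.IH[of "Suc i"] by simp
  qed simp
  from this[of _ 0 _ 0] have "(LINT x|lborel. deriv w x * fs j x) = (-1) ^ j * (LINT x|lborel. (deriv ^^ Suc j) w x * fs 0 x)"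
    if "test_fun fs" for fs j using that by simp
  then show ?thesis
    unfolding sobolev_H_def using L2_higher_deriv[OF a]
    by (intro exI[of _ "\<lambda>j. (deriv ^^ Suc j) w"]) auto
qed

section \<open>Compact support and interior smoothness for positive a\<close>

lemma w_vanishes:
  assumes a: "0 < a"
  obtains x0 where "x0 > 0" "w x0 = 0"
proof -
  have "\<exists>x>0. w x = 0"
  proof (rule ccontr)
    assume "\<not> (\<exists>x>0. w x = 0)"
    then have pos: "w x > 0" if "x > 0" for x using that w_nonneg[of x] by (metis less_eq_real_def)
    have bound: "Top w x < rfun w / a" if "x > 0" for x
      using base_pos[OF pos[OF that]] a rfun_pos by (simp add: base_def field_simps)
    define c where "c = excess 1 / pi"
    have c: "c > 0" using excess_1_pos by (simp add: c_def)
    have grow: "Top w 1 + c * ln x \<le> Top w x" if "x \<ge> 1" for x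
    proof -
      have "Top w 1 - c * ln 1 \<le> Top w x - c * ln x"
      proof (rule DERIV_nonneg_imp_nondecreasing[OF that])
        fix y :: real assume y: "1 \<le> y" "y \<le> x"
        have "c / y \<le> hil y / pi"
        proof -
          have "excess 1 / y \<le> excess y / y" using excess_ge[OF y(1)] y by (intro divide_right_mono) auto
          also have "\<dots> \<le> hil y" using hil_ge_excess[of y] y by simp
          finally have "excess 1 / y / pi \<le> hil y / pi" by (intro divide_right_mono) auto
          then show ?thesis by (simp add: c_def mult.commute)
        qed
        moreover have "((\<lambda>x. Top w x - c * ln x) has_real_derivative hil y / pi - c * (1 / y)) (at y)"
          using y by (intro DERIV_diff Top_deriv DERIV_cmult DERIV_ln_divide) auto
        ultimately show "\<exists>d. ((\<lambda>x. Top w x - c * ln x) has_real_derivative d) (at y) \<and> 0 \<le> d"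
          by (intro exI[of _ "hil y / pi - c * (1 / y)"]) auto
      qed
      then show ?thesis by simp
    qed
    \<comment> \<open>At x = exp t the logarithmic lower bound reaches the ceiling rfun w / a; the
      maximum with 0 ensures exp t \<ge> 1, where the growth estimate applies.\<close>
    define t where "t = max 0 ((rfun w / a - Top w 1) / c)"
    have "(rfun w / a - Top w 1) / c \<le> t" by (simp add: t_def)
    then have "rfun w / a - Top w 1 \<le> c * t" using c by (simp add: pos_divide_le_eq mult.commute)
    also have "\<dots> \<le> Top w (exp t) - Top w 1" using grow[of "exp t"] by (simp add: t_def)
    finally show False using bound[of "exp t"] by simp
  qed
  then show thesis using that by blast
qed

text \<open>Regularity of \<open>hil\<close> on (-b, b) needs that of w on a larger interval where w
  is still positive. Hence b is arbitrary in the induction and a margin d is spent at each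
  order.\<close>

lemma hoelder_C_w_pos:
  shows "0 < b \<Longrightarrow> 0 < w b \<Longrightarrow> hoelder_C n {-b<..<b} w"
proof (induction n arbitrary: b)
  case (Suc n)
  have "\<forall>\<^sub>F y in at_right b. 0 < w y"
    using w_isCont[of b] Suc.prems by (simp add: isCont_def order_tendsto_iff filterlim_at_split)
  then obtain c where c: "b < c" "\<And>y. b < y \<Longrightarrow> y < c \<Longrightarrow> 0 < w y"
    unfolding eventually_at_right_field by blast
  \<comment> \<open>Half of the gap, so that b + d lies strictly between b and c.\<close>
  define d where "d = (c - b) / 2"
  have d: "d > 0" "w (b + d) > 0" using c by (auto simp: d_def field_simps intro!: c(2))
  have "hoelder_C n {-(b + d)<..<b + d} w" using Suc.IH[of "b + d"] d Suc.prems by simp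
  then have hil: "hoelder_C n {-b<..<b} hil"
    by (intro hoelder_C_hil[of "{-b<..<b}" d "{-(b + d)<..<b + d}"]) (use d in auto)
  have low: "w b \<le> w x" if "x \<in> {-b<..<b}" for x
    using w_antimono[of "\<bar>x\<bar>" b] that by (auto simp: w_abs)
  show ?case
  proof (rule hoelder_C_improve[of _ UNIV, OF _ _ _ _ _ _ hil])
    show "\<exists>B. \<forall>x\<in>{-b<..<b}. w x powr q \<le> B" for q
    proof (cases "q \<ge> 0")
      case True
      then show ?thesis using w_nonneg w_le_1 by (intro exI[of _ 1]) (simp add: powr_le1)
    next
      case False
      then show ?thesis using low Suc.prems
        by (intro exI[of _ "w b powr q"]) (auto intro!: powr_mono2' )
    qed
    show "0 < w x" if "x \<in> {-b<..<b}" for x using low[OF that] Suc.prems by simp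
  qed auto
qed (simp add: hoelder_bdd_w)

end

theorem mainTheorem16:
  fixes a :: real and \<omega> :: "real \<Rightarrow> real"
  assumes "a < 0 \<or> (0 < a \<and> a < 1)"
    and "\<omega> \<in> Dset a"
    and "\<forall>x. Ra a \<omega> x = ereal (\<omega> x)"
  defines "L\<omega> \<equiv> Sup (ereal ` {x. \<omega> x > 0})"
  shows "(a < 0 \<longrightarrow> (\<forall>x. \<omega> x > 0) \<and> (\<exists>g. weak_deriv \<omega> g \<and> (\<forall>k. sobolev_H k g)))
       \<and> (0 < a \<longrightarrow> L\<omega> < \<infinity> \<and> (\<forall>x. ereal \<bar>x\<bar> > L\<omega> \<longrightarrow> \<omega> x = 0)
              \<and> smooth_on_set {x. - L\<omega> < ereal x \<and> ereal x < L\<omega>} \<omega>)"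
proof -
  interpret profile \<omega> by (rule profile_Dset[OF assms(2)])
  have "\<omega> 0 = 1" "\<And>x. max 0 (1 - x\<^sup>2) \<le> \<omega> x" using assms(2) unfolding Dset_def by auto
  then interpret fixed_point \<omega> a
    using assms(1,3) Dset_half_less_1[OF assms(2)] by unfold_locales auto
  show ?thesis
  proof (intro conjI impI)
    assume a: "a < 0"
    show "\<forall>x. \<omega> x > 0" using w_pos_neg[OF a] by blast
    show "\<exists>g. weak_deriv \<omega> g \<and> (\<forall>k. sobolev_H k g)"
      using weak_deriv_w[OF a] sobolev_deriv_w[OF a] by blast
  next
    assume a: "0 < a"
    obtain x0 where x0: "x0 > 0" "\<omega> x0 = 0" using w_vanishes[OF a] .
    have "x \<le> x0" if "\<omega> x > 0" for x
      using w_antimono[of x0 x] x0 that by (cases "x \<le> x0") auto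
    then have "L\<omega> \<le> ereal x0" unfolding L\<omega>_def by (intro Sup_least) auto
    then show "L\<omega> < \<infinity>" using le_less_trans by fastforce
    show "\<forall>x. ereal \<bar>x\<bar> > L\<omega> \<longrightarrow> \<omega> x = 0"
    proof (intro allI impI)
      fix x assume "ereal \<bar>x\<bar> > L\<omega>"
      moreover have "ereal \<bar>x\<bar> \<le> L\<omega>" if "\<omega> x > 0"
        unfolding L\<omega>_def by (rule Sup_upper) (use that in \<open>simp add: w_abs\<close>)
      ultimately show "\<omega> x = 0" using w_nonneg[of x] by (cases "\<omega> x > 0") auto
    qed
    have "((deriv ^^ n) \<omega> has_real_derivative (deriv ^^ Suc n) \<omega> x) (at x)"
      if "- L\<omega> < ereal x" "ereal x < L\<omega>" for n x
    proof -
      have "ereal \<bar>x\<bar> < L\<omega>" using that by (cases L\<omega>) auto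
      \<comment> \<open>The functions (deriv ^^ n) \<omega> are defined globally, so the interval on
        which regularity is invoked may depend on x.\<close>
      then obtain b where b: "\<omega> b > 0" "\<bar>x\<bar> < b" unfolding L\<omega>_def less_Sup_iff by auto
      have "hoelder_C (Suc n) {-b<..<b} \<omega>" by (rule hoelder_C_w_pos) (use b in auto)
      then show ?thesis by (rule hoelder_C_higher_deriv[rotated]) (use b in auto)
    qed
    then show "smooth_on_set {x. - L\<omega> < ereal x \<and> ereal x < L\<omega>} \<omega>"
      unfolding smooth_on_set_def by (intro exI[of _ "\<lambda>n. (deriv ^^ n) \<omega>"]) auto
  qed
qed

end
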